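(* Let $\rho$ be any unitary representation of $\mathbf G$ in a Hilbert space $H$. Then for all $\mathfrak g,\mathfrak h\in\mathbf K\setminus\mathbf G/\mathbf K$, $$\overline\rho(\mathfrak g)\,\overline\rho(\mathfrak h)=\overline\rho(\mathfrak g\star\mathfrak h).$$
   Context: Let $p$ be a prime, $\alpha\ge 0$ and $k\ge 1$ integers. $\mathbf G=\mathrm{GL}(\alpha+k\infty,\mathbb Q_p)$ is the group of invertible block matrices over $\mathbb Q_p$ of size $(\alpha+\infty+\dots+\infty)\times(\alpha+\infty+\dots+\infty)$ ($k$ copies of $\infty=\mathbb N$) which are finitary, i.e. $g-1$ has only finitely many nonzero entries. $\mathrm O(\infty,\mathbb Z_p)$ is the group of finitary infinite matrices $u$ with entries in $\mathbb Z_p$ with $uu^t=u^tu=1$. The map $\mathfrak I:\mathrm O(\infty,\mathbb Z_p)\to\mathbf G$ is $\mathfrak I(u)=\mathrm{diag}(1_\alpha,u,\dots,u)$ ($k$ copies of $u$), and $\mathbf K:=\mathfrak I(\mathrm O(\infty,\mathbb Z_p))$. Product of double cosets: let $\Theta_N\in\mathrm O(\infty,\mathbb Z_p)$ be the block matrix of size $N+N+\infty$, $\Theta_N=\begin{pmatrix}0&1_N&0\\1_N&0&0\\0&0&1_\infty\end{pmatrix}$. For $g\in\mathfrak g$, $h\in\mathfrak h$ the double coset $\mathbf K\,g\,\mathfrak I(\Theta_N)\,h\,\mathbf K$ is constant for all sufficiently large $N$, and its eventual value, which does not depend on the choice of $g,h$, is denoted $\mathfrak g\star\mathfrak h$. For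 a unitary representation $\rho$ of $\mathbf G$ in $H$, $H^{\mathbf K}$ is the subspace of $\mathbf K$-fixed vectors, $P^{\mathbf K}$ is the orthogonal projection onto $H^{\mathbf K}$, and for $g\in\mathbf G$ one sets $\overline\rho(g):=P^{\mathbf K}\rho(g)\big|_{H^{\mathbf K}}:H^{\mathbf K}\to H^{\mathbf K}$. This operator depends only on the double coset $\mathfrak g=\mathbf Kg\mathbf K$ and is denoted $\overline\rho(\mathfrak g)$. *)

theory Defs
  imports
    Complex_Main
    "HOL-Algebra.Group"
    "HOL-Library.FuncSet"
    "HOL-Library.Groups_Big_Fun"
    "HOL-Computational_Algebra.Fraction_Field"
    "Berlekamp_Zassenhaus.Finite_Field"
begin

section \<open>p-adic numbers\<close>

text \<open>
  The prime is \<^term>\<open>CARD('p)\<close> for a type \<open>'p\<close> of prime cardinality.  The p-adic integers are the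
  inverse limit of the rings \<open>Z/p^n\<close>, the class modulo \<open>p^n\<close> being given by its
  representative in \<open>{0..<p^n}\<close>.
\<close>

typedef (overloaded) ('p::prime_card) padic_int =
  "{x :: nat \<Rightarrow> int. \<forall>n. x n \<in> {0..<int CARD('p) ^ n} \<and> x (Suc n) mod int CARD('p) ^ n = x n}"
  morphisms residue_of Abs_padic_int
proof
  have "CARD('p) > 0" using prime_card[where ?'a = 'p] prime_gt_0_nat by blast
  then show "(\<lambda>n. 0) \<in> {x :: nat \<Rightarrow> int. \<forall>n. x n \<in> {0..<int CARD('p) ^ n} \<and>
      x (Suc n) mod int CARD('p) ^ n = x n}" by simp
qed

setup_lifting type_definition_padic_int

lemma CARD_pos: "0 < int CARD('p::prime_card) ^ n"
  using prime_card[where ?'a = 'p] prime_gt_0_nat by (metis of_nat_0_less_iff zero_less_power)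

lemma mod_Suc_power: "(a mod q ^ Suc n) mod q ^ n = a mod (q::int) ^ n"
  by (simp add: mod_mod_cancel)

lemma CARD_gt_1: "1 < int CARD('p::prime_card)"
  using prime_card[where ?'a = 'p] prime_gt_1_nat by (metis of_nat_1 of_nat_less_iff)

instantiation padic_int :: (prime_card) comm_ring_1
begin

lift_definition zero_padic_int :: "'a padic_int" is "\<lambda>n. 0"
  by (auto simp: CARD_pos)

lift_definition one_padic_int :: "'a padic_int" is "\<lambda>n. 1 mod int CARD('a) ^ n"
  by (simp add: CARD_pos mod_Suc_power del: power_Suc)

lift_definition plus_padic_int :: "'a padic_int \<Rightarrow> 'a padic_int \<Rightarrow> 'a padic_int"
  is "\<lambda>x y n. (x n + y n) mod int CARD('a) ^ n"
proof -
  fix x y :: "nat \<Rightarrow> int" and n :: nat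
  let ?q = "int CARD('a)"
  assume x: "\<And>n. x n \<in> {0..<?q ^ n} \<and> x (Suc n) mod ?q ^ n = x n"
    and y: "\<And>n. y n \<in> {0..<?q ^ n} \<and> y (Suc n) mod ?q ^ n = y n"
  have "(x (Suc n) + y (Suc n)) mod ?q ^ n = (x n + y n) mod ?q ^ n"
    using x y by (metis mod_add_eq)
  then show "(x n + y n) mod ?q ^ n \<in> {0..<?q ^ n} \<and>
      (x (Suc n) + y (Suc n)) mod ?q ^ Suc n mod ?q ^ n = (x n + y n) mod ?q ^ n"
    by (metis CARD_pos atLeastLessThan_iff mod_Suc_power pos_mod_bound pos_mod_sign)
qed

lift_definition times_padic_int :: "'a padic_int \<Rightarrow> 'a padic_int \<Rightarrow> 'a padic_int"
  is "\<lambda>x y n. (x n * y n) mod int CARD('a) ^ n"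
proof -
  fix x y :: "nat \<Rightarrow> int" and n :: nat
  let ?q = "int CARD('a)"
  assume x: "\<And>n. x n \<in> {0..<?q ^ n} \<and> x (Suc n) mod ?q ^ n = x n"
    and y: "\<And>n. y n \<in> {0..<?q ^ n} \<and> y (Suc n) mod ?q ^ n = y n"
  have "(x (Suc n) * y (Suc n)) mod ?q ^ n = (x n * y n) mod ?q ^ n"
    using x y by (metis mod_mult_eq)
  then show "(x n * y n) mod ?q ^ n \<in> {0..<?q ^ n} \<and>
      (x (Suc n) * y (Suc n)) mod ?q ^ Suc n mod ?q ^ n = (x n * y n) mod ?q ^ n"
    by (metis CARD_pos atLeastLessThan_iff mod_Suc_power pos_mod_bound pos_mod_sign)
qed

lift_definition uminus_padic_int :: "'a padic_int \<Rightarrow> 'a padic_int"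
  is "\<lambda>x n. (- x n) mod int CARD('a) ^ n"
proof -
  fix x :: "nat \<Rightarrow> int" and n :: nat
  let ?q = "int CARD('a)"
  assume x: "\<And>n. x n \<in> {0..<?q ^ n} \<and> x (Suc n) mod ?q ^ n = x n"
  have "(- x (Suc n)) mod ?q ^ n = (- x n) mod ?q ^ n"
    using x by (metis mod_minus_eq)
  then show "(- x n) mod ?q ^ n \<in> {0..<?q ^ n} \<and>
      (- x (Suc n)) mod ?q ^ Suc n mod ?q ^ n = (- x n) mod ?q ^ n"
    by (metis CARD_pos atLeastLessThan_iff mod_Suc_power pos_mod_bound pos_mod_sign)
qed

definition minus_padic_int :: "'a padic_int \<Rightarrow> 'a padic_int \<Rightarrow> 'a padic_int" where
  "minus_padic_int x y = x + (- y)"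

instance
proof
  fix a b c :: "'a padic_int"
  show "a * b * c = a * (b * c)"
    by transfer (auto simp: fun_eq_iff mod_simps ac_simps)
  show "a * b = b * a"
    by transfer (auto simp: fun_eq_iff ac_simps)
  show "1 * a = a"
    by transfer (auto simp: fun_eq_iff mod_simps)
  show "(a + b) * c = a * c + b * c"
    by transfer (auto simp: fun_eq_iff mod_simps algebra_simps)
  show "a + b + c = a + (b + c)"
    by transfer (auto simp: fun_eq_iff mod_simps ac_simps)
  show "a + b = b + a"
    by transfer (auto simp: fun_eq_iff ac_simps)
  show "0 + a = a"
    by transfer (auto simp: fun_eq_iff)
  show "- a + a = 0"
    by transfer (auto simp: fun_eq_iff mod_simps)
  show "a - b = a + - b"
    by (rule minus_padic_int_def)
  have "residue_of (0 :: 'a padic_int) 1 \<noteq> residue_of (1 :: 'a padic_int) 1"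
    using CARD_gt_1[where ?'p = 'a] by transfer simp
  then show "(0 :: 'a padic_int) \<noteq> 1"
    by metis
qed

end

lemma residue_of_mod:
  "residue_of (x :: 'p::prime_card padic_int) (n + m) mod int CARD('p) ^ n = residue_of x n"
proof (induction m)
  case 0
  show ?case using residue_of[of x] by simp
next
  case (Suc m)
  have "residue_of x (n + Suc m) mod int CARD('p) ^ (n + m) = residue_of x (n + m)"
    using residue_of[of x] by simp
  then show ?case
    using Suc by (metis le_add1 le_imp_power_dvd mod_mod_cancel)
qed

lemma prime_power_mult_dvd:
  fixes q :: int
  assumes "prime q" "q ^ (n + m) dvd a * b"
  shows "q ^ n dvd a \<or> q ^ m dvd b"
proof (cases "a = 0 \<or> b = 0")
  case False
  then have "n + m \<le> multiplicity q a + multiplicity q b"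
    using assms by (metis mult_eq_0_iff not_prime_unit power_dvd_iff_le_multiplicity
        prime_elem_multiplicity_mult_distrib prime_imp_prime_elem)
  then have "n \<le> multiplicity q a \<or> m \<le> multiplicity q b"
    by linarith
  then show ?thesis
    by (metis multiplicity_dvd')
qed auto

instance padic_int :: (prime_card) idom
proof
  fix x y :: "'a padic_int"
  let ?q = "int CARD('a)"
  assume "x \<noteq> 0" "y \<noteq> 0"
  then obtain n m where nm: "residue_of x n \<noteq> 0" "residue_of y m \<noteq> 0"
    by (metis residue_of_inject zero_padic_int.rep_eq ext)
  have "\<not> ?q ^ n dvd residue_of x (n + m)" "\<not> ?q ^ m dvd residue_of y (n + m)"
    using nm residue_of_mod[of x n m] residue_of_mod[of y m n]
    by (simp_all add: dvd_eq_mod_eq_0 add.commute)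
  then have "\<not> ?q ^ (n + m) dvd residue_of x (n + m) * residue_of y (n + m)"
    using prime_power_mult_dvd prime_card_int[where ?'a = 'a] by blast
  then have "residue_of (x * y) (n + m) \<noteq> residue_of 0 (n + m)"
    by (simp add: times_padic_int.rep_eq zero_padic_int.rep_eq dvd_eq_mod_eq_0)
  then show "x * y \<noteq> 0"
    by metis
qed

type_synonym 'p padic = "'p padic_int fract"

definition Zp :: "'p::prime_card padic set" where
  "Zp = range (\<lambda>x. Fract x 1)"


section \<open>Finitary matrices\<close>

text \<open>
  A matrix with rows and columns indexed by a set \<open>I\<close> is a function vanishing
  outside \<open>I \<times> I\<close>; its unit matrix is \<open>mat_one I\<close>.
\<close>

type_synonym ('i, 'a) matrix = "'i \<Rightarrow> 'i \<Rightarrow> 'a"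

definition mat_one :: "'i set \<Rightarrow> ('i, 'a::zero_neq_one) matrix" where
  "mat_one I i j = (if i \<in> I \<and> i = j then 1 else 0)"

text \<open>\<open>Sum_any\<close> sums over the support, which is finite for products of finitary matrices.\<close>

definition mat_mult :: "('i, 'a) matrix \<Rightarrow> ('i, 'a) matrix \<Rightarrow> ('i, 'a::semiring_0) matrix" where
  "mat_mult A B i j = (\<Sum>l. A i l * B l j)"

definition mat_transpose :: "('i, 'a) matrix \<Rightarrow> ('i, 'a) matrix" where
  "mat_transpose A i j = A j i"

definition finitary :: "'i set \<Rightarrow> ('i, 'a::zero_neq_one) matrix \<Rightarrow> bool" where
  "finitary I A \<longleftrightarrow> (\<forall>i j. A i j \<noteq> 0 \<longrightarrow> i \<in> I \<and> j \<in> I) \<and>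
     finite {(i, j). A i j \<noteq> mat_one I i j}"

definition GL_fin :: "'i set \<Rightarrow> ('i, 'a::field) matrix monoid" where
  "GL_fin I = \<lparr>carrier = {A. finitary I A \<and>
       (\<exists>B. finitary I B \<and> mat_mult A B = mat_one I \<and> mat_mult B A = mat_one I)},
     monoid.mult = mat_mult, one = mat_one I\<rparr>"

text \<open>
  Indices of size \<open>\<alpha> + k\<infinity>\<close>: \<open>Inl a\<close> with \<open>a < \<alpha>\<close> for the finite block,
  \<open>Inr (c, i)\<close> for position \<open>i\<close> in the \<open>c\<close>-th infinite block, \<open>c < k\<close>.
\<close>

type_synonym block_index = "nat + nat \<times> nat"

definition block_indices :: "nat \<Rightarrow> nat \<Rightarrow> block_index set" where
  "block_indices \<alpha> k = {..<\<alpha>} <+> ({..<k} \<times> UNIV)"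

definition GL_inf :: "nat \<Rightarrow> nat \<Rightarrow> (block_index, 'p::prime_card padic) matrix monoid" where
  "GL_inf \<alpha> k = GL_fin (block_indices \<alpha> k)"

definition O_inf :: "(nat, 'p::prime_card padic) matrix set" where
  "O_inf = {u. finitary UNIV u \<and> (\<forall>i j. u i j \<in> Zp) \<and>
     mat_mult u (mat_transpose u) = mat_one UNIV \<and> mat_mult (mat_transpose u) u = mat_one UNIV}"

fun diag_embed :: "nat \<Rightarrow> nat \<Rightarrow> (nat, 'a::zero_neq_one) matrix \<Rightarrow> (block_index, 'a) matrix" where
  "diag_embed \<alpha> k u (Inl a) (Inl b) = (if a < \<alpha> \<and> a = b then 1 else 0)"
| "diag_embed \<alpha> k u (Inr (c, i)) (Inr (d, j)) = (if c < k \<and> c = d then u i j else 0)"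
| "diag_embed \<alpha> k u _ _ = 0"

definition K_sub :: "nat \<Rightarrow> nat \<Rightarrow> (block_index, 'p::prime_card padic) matrix set" where
  "K_sub \<alpha> k = diag_embed \<alpha> k ` O_inf"

definition Theta :: "nat \<Rightarrow> (nat, 'a::zero_neq_one) matrix" where
  "Theta N i j =
     (if i < N \<and> j = i + N \<or> j < N \<and> i = j + N \<or> 2 * N \<le> i \<and> i = j then 1 else 0)"


section \<open>Double cosets and their product\<close>

definition double_coset :: "('a, 'b) monoid_scheme \<Rightarrow> 'a set \<Rightarrow> 'a \<Rightarrow> 'a set" where
  "double_coset G K g = {x \<otimes>\<^bsub>G\<^esub> g \<otimes>\<^bsub>G\<^esub> y | x y. x \<in> K \<and> y \<in> K}"

definition double_cosets :: "('a, 'b) monoid_scheme \<Rightarrow> 'a set \<Rightarrow> 'a set set" where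
  "double_cosets G K = double_coset G K ` carrier G"

definition dc_star :: "nat \<Rightarrow> nat \<Rightarrow> (block_index, 'p::prime_card padic) matrix set \<Rightarrow>
    (block_index, 'p padic) matrix set \<Rightarrow> (block_index, 'p padic) matrix set" where
  "dc_star \<alpha> k \<gg> \<hh> = (THE \<dd>. \<forall>g\<in>\<gg>. \<forall>h\<in>\<hh>. \<forall>\<^sub>F N in sequentially.
     double_coset (GL_inf \<alpha> k) (K_sub \<alpha> k)
       (g \<otimes>\<^bsub>GL_inf \<alpha> k\<^esub> diag_embed \<alpha> k (Theta N) \<otimes>\<^bsub>GL_inf \<alpha> k\<^esub> h) = \<dd>)"


section \<open>Complex Hilbert spaces and unitary representations\<close>

text \<open>
  Completeness comes from \<^class>\<open>banach\<close>; positivity and definiteness of the inner product,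
  which is linear in the first argument, follow from the last axiom and the norm axioms.
\<close>

class complex_hilbert = banach +
  fixes scaleC :: "complex \<Rightarrow> 'a \<Rightarrow> 'a"
    and cinner :: "'a \<Rightarrow> 'a \<Rightarrow> complex"
  assumes scaleC_add_right: "scaleC a (x + y) = scaleC a x + scaleC a y"
    and scaleC_add_left: "scaleC (a + b) x = scaleC a x + scaleC b x"
    and scaleC_scaleC: "scaleC a (scaleC b x) = scaleC (a * b) x"
    and scaleC_of_real: "scaleC (complex_of_real r) x = scaleR r x"
    and cinner_commute: "cinner x y = cnj (cinner y x)"
    and cinner_add_left: "cinner (x + y) z = cinner x z + cinner y z"
    and cinner_scaleC_left: "cinner (scaleC a x) y = a * cinner x y"
    and norm_eq_sqrt_cinner: "norm x = sqrt (Re (cinner x x))"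

instantiation complex :: complex_hilbert
begin

definition "scaleC a (x :: complex) = a * x"
definition "cinner (x :: complex) y = x * cnj y"

instance
  by standard (auto simp: scaleC_complex_def cinner_complex_def algebra_simps scaleR_conv_of_real
      cmod_def power2_eq_square)

end

definition unitary_operator :: "('h::complex_hilbert \<Rightarrow> 'h) \<Rightarrow> bool" where
  "unitary_operator U \<longleftrightarrow> (\<forall>x y. U (x + y) = U x + U y) \<and>
     (\<forall>a x. U (scaleC a x) = scaleC a (U x)) \<and>
     (\<forall>x y. cinner (U x) (U y) = cinner x y) \<and> surj U"

definition unitary_rep :: "('g, 'b) monoid_scheme \<Rightarrow> ('g \<Rightarrow> 'h::complex_hilbert \<Rightarrow> 'h) \<Rightarrow> bool" where
  "unitary_rep G \<rho> \<longleftrightarrow> (\<forall>g\<in>carrier G. unitary_operator (\<rho> g)) \<and> \<rho> \<one>\<^bsub>G\<^esub> = id \<and>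
     (\<forall>g\<in>carrier G. \<forall>h\<in>carrier G. \<rho> (g \<otimes>\<^bsub>G\<^esub> h) = \<rho> g \<circ> \<rho> h)"

definition fixed_vectors :: "('g \<Rightarrow> 'h \<Rightarrow> 'h) \<Rightarrow> 'g set \<Rightarrow> 'h set" where
  "fixed_vectors \<rho> K = {v. \<forall>g\<in>K. \<rho> g v = v}"

definition orthogonal_projection :: "'h::complex_hilbert set \<Rightarrow> 'h \<Rightarrow> 'h" where
  "orthogonal_projection M x = (THE y. y \<in> M \<and> (\<forall>z\<in>M. cinner (x - y) z = 0))"

text \<open>Operators on \<open>fixed_vectors \<rho> K\<close> are functions that are \<open>undefined\<close> off this subspace.\<close>

definition rho_bar :: "('g \<Rightarrow> 'h::complex_hilbert \<Rightarrow> 'h) \<Rightarrow> 'g set \<Rightarrow> 'g \<Rightarrow> 'h \<Rightarrow> 'h" where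
  "rho_bar \<rho> K g =
     restrict (\<lambda>v. orthogonal_projection (fixed_vectors \<rho> K) (\<rho> g v)) (fixed_vectors \<rho> K)"

definition rho_bar_dc :: "('g \<Rightarrow> 'h::complex_hilbert \<Rightarrow> 'h) \<Rightarrow> 'g set \<Rightarrow> 'g set \<Rightarrow> 'h \<Rightarrow> 'h" where
  "rho_bar_dc \<rho> K \<gg> = (THE T. \<forall>g\<in>\<gg>. rho_bar \<rho> K g = T)"

end

theory Submission
  imports Defs "HOL-Analysis.Elementary_Metric_Spaces" "HOL-Combinatorics.Permutations"
begin

text \<open>
  Let \<open>K\<^sub>m\<close> be the subgroup of \<open>K\<close> acting trivially on the first \<open>m\<close> coordinates of each infinite
  block. Every element of the group commutes with \<open>K\<^sub>m\<close> for large \<open>m\<close>, so for a \<open>K\<close>-fixed vector \<open>v\<close>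
  the vector \<open>w = \<rho> h v\<close> is \<open>K\<^sub>m\<close>-fixed. On such vectors \<open>\<rho> (\<Theta>\<^sub>N)\<close> converges weakly to the projection
  onto the \<open>K\<close>-fixed vectors: for \<open>u \<in> K\<close> and large \<open>N\<close> one has \<open>u \<Theta>\<^sub>N = \<Theta>\<^sub>N u'\<close> with \<open>u' \<in> K\<^sub>m\<close>, hence
  \<open>\<rho> (\<Theta>\<^sub>N) w\<close> is eventually fixed by \<open>u\<close> and orthogonal to \<open>\<rho> u x - x\<close>, and these vectors together
  with the \<open>K\<close>-fixed ones span a dense subspace. Taking \<open>N \<rightarrow> \<infinity>\<close> in the matrix coefficients of
  \<open>\<rho> (g \<Theta>\<^sub>N h)\<close>, which are eventually constant on \<open>K\<close>-fixed vectors, gives the theorem.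
\<close>

section \<open>Orthogonal projections in complex Hilbert spaces\<close>

lemma cinner_zero_left [simp]: "cinner 0 (y::'h::complex_hilbert) = 0"
  using cinner_add_left[of 0 0 y] by simp

lemma cinner_minus_left: "cinner (- x) (y::'h::complex_hilbert) = - cinner x y"
  using cinner_add_left[of x "-x" y] by (simp add: eq_neg_iff_add_eq_0 add.commute)

lemma cinner_diff_left: "cinner (x - y) (z::'h::complex_hilbert) = cinner x z - cinner y z"
  using cinner_add_left[of x "-y" z] by (simp add: cinner_minus_left)

lemma cinner_add_right: "cinner (x::'h::complex_hilbert) (y + z) = cinner x y + cinner x z"
  by (metis cinner_commute cinner_add_left complex_cnj_add)

lemma cinner_zero_right [simp]: "cinner (x::'h::complex_hilbert) 0 = 0"
  using cinner_add_right[of x 0 0] by simp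

lemma cinner_diff_right: "cinner (x::'h::complex_hilbert) (y - z) = cinner x y - cinner x z"
  by (metis cinner_commute cinner_diff_left complex_cnj_diff)

lemma cinner_scaleC_right: "cinner (x::'h::complex_hilbert) (scaleC a y) = cnj a * cinner x y"
  by (metis cinner_commute cinner_scaleC_left complex_cnj_mult)

lemma cinner_scaleR_right: "cinner (x::'h::complex_hilbert) (r *\<^sub>R y) = complex_of_real r * cinner x y"
  by (metis cinner_scaleC_right complex_cnj_complex_of_real scaleC_of_real)

lemma cinner_scaleR_left: "cinner (r *\<^sub>R (x::'h::complex_hilbert)) y = complex_of_real r * cinner x y"
  by (metis cinner_scaleC_left scaleC_of_real)

lemma cinner_self: "cinner (x::'h::complex_hilbert) x = complex_of_real ((norm x)\<^sup>2)"
proof -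
  have "Im (cinner x x) = 0"
    using arg_cong[OF cinner_commute[of x x], of Im] by simp
  moreover have "Re (cinner x x) = (norm x)\<^sup>2"
    using norm_eq_sqrt_cinner[of x] norm_ge_zero[of x]
    by (metis norm_ge_zero real_sqrt_ge_0_iff real_sqrt_pow2)
  ultimately show ?thesis by (simp add: complex_eq_iff)
qed

lemma norm_add_cinner:
  "(norm (x + y))\<^sup>2 = (norm x)\<^sup>2 + 2 * Re (cinner x y) + (norm (y::'h::complex_hilbert))\<^sup>2"
proof -
  have "cinner (x + y) (x + y) = cinner x x + cinner x y + cnj (cinner x y) + cinner y y"
    by (simp add: cinner_add_left cinner_add_right cinner_commute[of y x])
  from arg_cong[OF this, of Re] show ?thesis by (simp only: cinner_self) (simp del: of_real_power)
qed

lemma norm_diff_cinner: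
  "(norm (x - y))\<^sup>2 = (norm x)\<^sup>2 - 2 * Re (cinner x y) + (norm (y::'h::complex_hilbert))\<^sup>2"
  using norm_add_cinner[of "x - y" y] cinner_self[of y]
  by (simp add: cinner_diff_left del: of_real_power)

lemma parallelogram:
  "(norm (x + y))\<^sup>2 + (norm (x - y))\<^sup>2 = 2 * (norm x)\<^sup>2 + 2 * (norm (y::'h::complex_hilbert))\<^sup>2"
  by (simp add: norm_add_cinner norm_diff_cinner)

text \<open>Subtracting from \<open>x\<close> its component along \<open>z\<close> lowers the
  squared norm by \<open>|cinner x z|^2 / |z|^2\<close>, so minimality forces the inner product to
  vanish.\<close>

lemma cinner_eq_0_if_min:
  fixes x z :: "'h::complex_hilbert"
  assumes min: "\<And>c. norm x \<le> norm (x - scaleC c z)"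
  shows "cinner x z = 0"
proof (cases "z = 0")
  case False
  \<comment> \<open>This \<open>c\<close> makes \<open>scaleC c z\<close> the orthogonal projection
    of \<open>x\<close> onto the line spanned by \<open>z\<close>.\<close>
  define c where "c = cinner x z / complex_of_real ((norm z)\<^sup>2)"
  have nz: "(norm z)\<^sup>2 > 0" using False by simp
  have "(norm (scaleC c z))\<^sup>2 = (cmod (cinner x z))\<^sup>2 / (norm z)\<^sup>2"
  proof -
    have "cinner (scaleC c z) (scaleC c z) = (c * cnj c) * cinner z z"
      by (simp add: cinner_scaleC_left cinner_scaleC_right)
    also have "\<dots> = complex_of_real ((cmod c)\<^sup>2 * (norm z)\<^sup>2)"
      using complex_norm_square[of c] by (simp add: cinner_self)
    finally have "(norm (scaleC c z))\<^sup>2 = (cmod c)\<^sup>2 * (norm z)\<^sup>2"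
      by (metis cinner_self of_real_eq_iff)
    then show ?thesis
      using nz by (simp add: c_def norm_divide power2_eq_square norm_mult)
  qed
  moreover have "Re (cinner x (scaleC c z)) = (cmod (cinner x z))\<^sup>2 / (norm z)\<^sup>2"
  proof -
    have "cinner x (scaleC c z) = complex_of_real ((cmod (cinner x z))\<^sup>2 / (norm z)\<^sup>2)"
      using complex_norm_square[of "cinner x z"]
      by (simp add: cinner_scaleC_right c_def mult.commute)
    then show ?thesis by (metis Re_complex_of_real)
  qed
  ultimately have "(norm (x - scaleC c z))\<^sup>2 = (norm x)\<^sup>2 - (cmod (cinner x z))\<^sup>2 / (norm z)\<^sup>2"
    by (simp add: norm_diff_cinner)
  moreover have "(norm x)\<^sup>2 \<le> (norm (x - scaleC c z))\<^sup>2"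
    using min by (simp add: power_mono)
  ultimately have "(cmod (cinner x z))\<^sup>2 / (norm z)\<^sup>2 \<le> 0" by simp
  then have "(cmod (cinner x z))\<^sup>2 \<le> 0"
    using nz by (metis divide_le_0_iff not_less)
  then show ?thesis by simp
qed simp

text \<open>The real part of Cauchy-Schwarz, read off from the squared norm of a difference of
  \<open>x\<close> and \<open>y\<close> rescaled to equal length.\<close>

lemma Re_cinner_le: "Re (cinner x y) \<le> norm x * norm (y::'h::complex_hilbert)"
proof (cases "x = 0 \<or> y = 0")
  case False
  then have pos: "norm x > 0" "norm y > 0" by auto
  have "0 \<le> (norm (norm y *\<^sub>R x - norm x *\<^sub>R y))\<^sup>2" by simp
  also have "\<dots> = 2 * (norm x * norm y)\<^sup>2 - 2 * (norm x * norm y) * Re (cinner x y)"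
    by (simp add: norm_diff_cinner cinner_scaleR_left cinner_scaleR_right power_mult_distrib
        algebra_simps)
  finally have "(norm x * norm y) * Re (cinner x y) \<le> (norm x * norm y) * (norm x * norm y)"
    by (simp add: power2_eq_square algebra_simps)
  then show ?thesis using pos by simp
qed auto

text \<open>Full Cauchy-Schwarz: multiplying \<open>x\<close> by a phase \<open>s\<close> makes the
  inner product real and nonnegative without changing the norm, which reduces to the bound on real
  parts.\<close>

lemma norm_cinner_le: "cmod (cinner x y) \<le> norm x * norm (y::'h::complex_hilbert)"
proof (cases "cinner x y = 0")
  case False
  define s where "s = cnj (cinner x y) / complex_of_real (cmod (cinner x y))"
  have "cmod s = 1" using False by (simp add: s_def norm_divide)
  have "cinner (scaleC s x) (scaleC s x) = (s * cnj s) * cinner x x"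
    by (simp add: cinner_scaleC_left cinner_scaleC_right)
  also have "\<dots> = cinner x x"
    using \<open>cmod s = 1\<close> by (simp add: complex_norm_square[symmetric])
  finally have n: "norm (scaleC s x) = norm x"
    by (simp add: norm_eq_sqrt_cinner)
  have "cinner (scaleC s x) y = complex_of_real (cmod (cinner x y))"
    using False by (simp add: s_def cinner_scaleC_left mult.commute[of "cnj _"]
        complex_norm_square[symmetric] power2_eq_square)
  then show ?thesis
    using Re_cinner_le[of "scaleC s x" y] n by simp
qed simp

section \<open>Closed subspaces and best approximation\<close>

definition csubspace :: "'h::complex_hilbert set \<Rightarrow> bool" where
  "csubspace M \<longleftrightarrow> 0 \<in> M \<and> (\<forall>x\<in>M. \<forall>y\<in>M. x + y \<in> M) \<and> (\<forall>a. \<forall>x\<in>M. scaleC a x \<in> M)"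

lemma csubspace_scaleR: "csubspace M \<Longrightarrow> x \<in> M \<Longrightarrow> r *\<^sub>R x \<in> M"
  unfolding csubspace_def by (metis scaleC_of_real)

lemma csubspace_diff:
  assumes "csubspace M" "x \<in> M" "y \<in> M"
  shows "x - y \<in> M"
proof -
  have "x + (-1) *\<^sub>R y \<in> M"
    using assms csubspace_scaleR unfolding csubspace_def by blast
  then show ?thesis by simp
qed

text \<open>The parallelogram law makes a minimising sequence Cauchy. Its limit exists by
  completeness and stays in \<open>M\<close> because \<open>M\<close> is closed.\<close>

lemma nearest_point_exists:
  fixes M :: "'h::complex_hilbert set"
  assumes "csubspace M" "closed M"
  shows "\<exists>y\<in>M. \<forall>z\<in>M. norm (x - y) \<le> norm (x - z)"
proof -
  define d where "d = Inf ((\<lambda>z. norm (x - z)) ` M)"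
  have ne: "M \<noteq> {}" using assms(1) by (auto simp: csubspace_def)
  have bdd: "bdd_below ((\<lambda>z. norm (x - z)) ` M)" by (rule bdd_belowI[of _ 0]) auto
  have d_le: "d \<le> norm (x - z)" if "z \<in> M" for z
    unfolding d_def using that bdd by (auto intro: cInf_lower)
  have d0: "0 \<le> d" unfolding d_def using ne by (auto intro: cInf_greatest)
  have "\<exists>z\<in>M. norm (x - z) < d + 1 / real (Suc n)" for n
  proof -
    have "Inf ((\<lambda>z. norm (x - z)) ` M) < d + 1 / real (Suc n)" by (simp add: d_def)
    then show ?thesis using cInf_lessD[of "(\<lambda>z. norm (x - z)) ` M"] ne by blast
  qed
  then obtain y where yM: "\<And>n. y n \<in> M" and y: "\<And>n. norm (x - y n) < d + 1 / real (Suc n)"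
    by metis
  have lim: "(\<lambda>n. norm (x - y n)) \<longlonglongrightarrow> d"
  proof (rule tendsto_sandwich[of "\<lambda>_. d" _ _ "\<lambda>n. d + 1 / real (Suc n)"])
    show "(\<lambda>n. d + 1 / real (Suc n)) \<longlonglongrightarrow> d"
      using tendsto_add[OF tendsto_const LIMSEQ_inverse_real_of_nat, of d]
      by (simp add: inverse_eq_divide)
  qed (use d_le yM y in \<open>auto simp del: of_nat_Suc intro!: always_eventually less_imp_le\<close>)
  \<comment> \<open>The midpoint of \<open>y i\<close> and \<open>y j\<close> lies in
    \<open>M\<close>, hence is at distance at least \<open>d\<close> from \<open>x\<close>. The
    parallelogram law turns this into an upper bound for the distance of the two points.\<close>
  have sq: "(norm (y i - y j))\<^sup>2 \<le> 2 * ((norm (x - y i))\<^sup>2 - d\<^sup>2) + 2 * ((norm (x - y j))\<^sup>2 - d\<^sup>2)" for i j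
  proof -
    have "(1/2) *\<^sub>R (y i + y j) \<in> M"
      using assms(1) yM csubspace_scaleR unfolding csubspace_def by blast
    then have "d \<le> norm (x - (1/2) *\<^sub>R (y i + y j))" by (rule d_le)
    moreover have "(x - y i) + (x - y j) = 2 *\<^sub>R (x - (1/2) *\<^sub>R (y i + y j))"
      by (simp add: algebra_simps scaleR_2)
    ultimately have "2 * d \<le> norm ((x - y i) + (x - y j))" by simp
    then have "(2 * d)\<^sup>2 \<le> (norm ((x - y i) + (x - y j)))\<^sup>2"
      using d0 by (intro power_mono) auto
    moreover have "norm ((x - y i) - (x - y j)) = norm (y i - y j)"
      by (simp add: norm_minus_commute)
    ultimately show ?thesis
      using parallelogram[of "x - y i" "x - y j"] by (simp add: power_mult_distrib)
  qed
  have "(\<lambda>n. (norm (x - y n))\<^sup>2 - d\<^sup>2) \<longlonglongrightarrow> 0"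
    using tendsto_diff[OF tendsto_power[OF lim, of 2] tendsto_const[of "d\<^sup>2"]] by simp
  note small = this
  have "Cauchy y"
  proof (rule CauchyI)
    fix e :: real assume e: "0 < e"
    then have "\<forall>\<^sub>F n in sequentially. (norm (x - y n))\<^sup>2 - d\<^sup>2 < e\<^sup>2 / 4"
      using order_tendstoD(2)[OF small, of "e\<^sup>2 / 4"] by simp
    then obtain n0 where n0: "\<And>n. n \<ge> n0 \<Longrightarrow> (norm (x - y n))\<^sup>2 - d\<^sup>2 < e\<^sup>2 / 4"
      by (auto simp: eventually_sequentially)
    have "norm (y i - y j) < e" if "i \<ge> n0" "j \<ge> n0" for i j
    proof -
      have "(norm (y i - y j))\<^sup>2 < e\<^sup>2"
        using sq[of i j] n0[OF that(1)] n0[OF that(2)] by argo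
      then show ?thesis using e by (simp add: power_less_imp_less_base)
    qed
    then show "\<exists>M. \<forall>m\<ge>M. \<forall>n\<ge>M. norm (y m - y n) < e" by blast
  qed
  then obtain l where l: "y \<longlonglongrightarrow> l" using Cauchy_convergent convergent_def by blast
  have "l \<in> M" using assms(2) yM l closed_sequentially by blast
  moreover have "norm (x - l) = d"
    using LIMSEQ_unique[OF tendsto_norm[OF tendsto_diff[OF tendsto_const l]] lim] .
  ultimately show ?thesis using d_le by blast
qed

text \<open>Justifies the definite description in \<open>orthogonal_projection\<close>. A nearest
  point is minimal in every direction of \<open>M\<close>, which gives orthogonality; the difference
  of two candidates lies in \<open>M\<close> and is orthogonal to itself.\<close>

lemma orthogonal_projection_exists1:
  fixes M :: "'h::complex_hilbert set"
  assumes "csubspace M" "closed M"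
  shows "\<exists>!y. y \<in> M \<and> (\<forall>z\<in>M. cinner (x - y) z = 0)"
proof -
  obtain y where y: "y \<in> M" "\<And>z. z \<in> M \<Longrightarrow> norm (x - y) \<le> norm (x - z)"
    using nearest_point_exists[OF assms] by blast
  have "cinner (x - y) z = 0" if "z \<in> M" for z
  proof (rule cinner_eq_0_if_min)
    fix c
    have "y + scaleC c z \<in> M" using assms(1) y(1) that by (auto simp: csubspace_def)
    from y(2)[OF this] show "norm (x - y) \<le> norm (x - y - scaleC c z)"
      by (simp add: algebra_simps)
  qed
  moreover have "y' = y''" if "y' \<in> M" "\<forall>z\<in>M. cinner (x - y') z = 0"
    "y'' \<in> M" "\<forall>z\<in>M. cinner (x - y'') z = 0" for y' y''
  proof -
    have "y' - y'' \<in> M" using csubspace_diff assms(1) that by blast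
    then have "cinner (x - y'') (y' - y'') - cinner (x - y') (y' - y'') = 0" using that by simp
    then have "cinner (y' - y'') (y' - y'') = 0" by (simp add: cinner_diff_left[symmetric])
    then show ?thesis by (simp add: cinner_self)
  qed
  ultimately show ?thesis using y(1) by blast
qed

lemma
  fixes M :: "'h::complex_hilbert set"
  assumes "csubspace M" "closed M"
  shows orthogonal_projection_in: "orthogonal_projection M x \<in> M"
    and orthogonal_projection_orth: "z \<in> M \<Longrightarrow> cinner (x - orthogonal_projection M x) z = 0"
    and orthogonal_projection_eqI:
      "y \<in> M \<Longrightarrow> (\<And>z. z \<in> M \<Longrightarrow> cinner (x - y) z = 0) \<Longrightarrow> orthogonal_projection M x = y"
  using theI'[OF orthogonal_projection_exists1[OF assms, of x]]
    the1_equality[OF orthogonal_projection_exists1[OF assms, of x]]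
  unfolding orthogonal_projection_def by blast+

section \<open>Test vectors for weak convergence\<close>

lemma csubspace_cinner_tendsto_0: "csubspace {x. (\<lambda>N::nat. cinner (a N) x) \<longlonglongrightarrow> 0}"
  unfolding csubspace_def
  by (auto simp: cinner_add_right cinner_scaleC_right intro: tendsto_add_zero tendsto_mult_right_zero)

text \<open>By Cauchy-Schwarz, the uniform bound on \<open>a\<close> makes the error from replacing
  \<open>l\<close> by a nearby \<open>x n\<close> small for all \<open>N\<close> at once. Hence weak
  convergence need only be tested on vectors spanning a dense subspace.\<close>

lemma closed_cinner_tendsto_0:
  assumes bound: "\<And>N. norm (a N) \<le> B"
  shows "closed {x. (\<lambda>N::nat. cinner (a N) x) \<longlonglongrightarrow> 0}"
  unfolding closed_sequential_limits
proof (intro allI impI, elim conjE)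
  fix x l assume x: "\<forall>n. x n \<in> {x. (\<lambda>N. cinner (a N) x) \<longlonglongrightarrow> 0}" and "x \<longlonglongrightarrow> l"
  have B: "B \<ge> 0" using bound[of 0] norm_ge_zero[of "a 0"] by linarith
  have "(\<lambda>N. cinner (a N) l) \<longlonglongrightarrow> 0"
  proof (rule LIMSEQ_I)
    fix e :: real assume e: "0 < e"
    \<comment> \<open>Using \<open>B + 1\<close> instead of \<open>B\<close> keeps the denominator
      positive when \<open>B = 0\<close>.\<close>
    define r where "r = e / (2 * (B + 1))"
    have "r > 0" using e B by (simp add: r_def)
    then obtain n where n: "norm (x n - l) < r"
      using LIMSEQ_D[OF \<open>x \<longlonglongrightarrow> l\<close>] by blast
    obtain N0 where N0: "\<And>N. N \<ge> N0 \<Longrightarrow> norm (cinner (a N) (x n)) < e / 2"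
      using LIMSEQ_D[of "\<lambda>N. cinner (a N) (x n)" 0 "e / 2"] x e by auto
    have "norm (cinner (a N) l) < e" if "N \<ge> N0" for N
    proof -
      have "cinner (a N) l = cinner (a N) (x n) - cinner (a N) (x n - l)"
        by (simp add: cinner_diff_right)
      then have "norm (cinner (a N) l) \<le> norm (cinner (a N) (x n)) + norm (cinner (a N) (x n - l))"
        by (metis norm_triangle_ineq4)
      moreover have "norm (cinner (a N) (x n - l)) \<le> norm (a N) * norm (x n - l)"
        by (rule norm_cinner_le)
      moreover have "norm (a N) * norm (x n - l) \<le> (B + 1) * r"
        using bound[of N] n B by (intro mult_mono) auto
      moreover have "(B + 1) * r = e / 2" using B by (simp add: r_def field_simps)
      ultimately show ?thesis using N0[OF that] by linarith
    qed
    then show "\<exists>no. \<forall>N\<ge>no. norm (cinner (a N) l - 0) < e" by auto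
  qed
  then show "l \<in> {x. (\<lambda>N. cinner (a N) x) \<longlonglongrightarrow> 0}" by simp
qed

section \<open>Unitary operators and their fixed vectors\<close>

lemma unitary_operatorD:
  fixes U :: "'h::complex_hilbert \<Rightarrow> 'h"
  assumes "unitary_operator U"
  shows "U (x + y) = U x + U y" "U (scaleC a x) = scaleC a (U x)" "cinner (U x) (U y) = cinner x y"
    "norm (U x) = norm x" "U (x - y) = U x - U y"
proof -
  show add: "U (x + y) = U x + U y" for x y using assms by (auto simp: unitary_operator_def)
  show "U (x - y) = U x - U y" using add[of "x - y" y] by (simp add: algebra_simps)
qed (use assms in \<open>auto simp: unitary_operator_def norm_eq_sqrt_cinner\<close>)

lemma csubspace_fixed_vectors:
  assumes "\<And>g. g \<in> K \<Longrightarrow> unitary_operator (\<rho> g)"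
  shows "csubspace (fixed_vectors \<rho> K)"
proof -
  have "\<rho> g 0 = 0" if "g \<in> K" for g
    using unitary_operatorD(1)[OF assms[OF that], of 0 0] by simp
  then show ?thesis
    using assms by (auto simp: csubspace_def fixed_vectors_def unitary_operatorD)
qed

text \<open>Each \<open>\<rho> g\<close> is an isometry fixing every \<open>x n\<close>, so the
  sequence also converges to \<open>\<rho> g l\<close>; uniqueness of limits gives
  \<open>\<rho> g l = l\<close>.\<close>

lemma closed_fixed_vectors:
  assumes "\<And>g. g \<in> K \<Longrightarrow> unitary_operator (\<rho> g)"
  shows "closed (fixed_vectors \<rho> K)"
  unfolding closed_sequential_limits
proof (intro allI impI, elim conjE)
  fix x l assume x: "\<forall>n. x n \<in> fixed_vectors \<rho> K" and lim: "x \<longlonglongrightarrow> l"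
  have "\<rho> g l = l" if g: "g \<in> K" for g
  proof -
    have "(\<lambda>n. norm (x n - l)) \<longlonglongrightarrow> 0"
      using lim by (simp add: LIM_zero_iff tendsto_norm_zero)
    moreover have "norm (x n - \<rho> g l) = norm (x n - l)" for n
      using unitary_operatorD(4)[OF assms[OF g], of "x n - l"]
        unitary_operatorD(5)[OF assms[OF g], of "x n" l] x g by (simp add: fixed_vectors_def)
    ultimately have "(\<lambda>n. norm (x n - \<rho> g l)) \<longlonglongrightarrow> 0" by simp
    then have "x \<longlonglongrightarrow> \<rho> g l" by (simp add: tendsto_norm_zero_iff LIM_zero_iff)
    then show ?thesis using lim LIMSEQ_unique by blast
  qed
  then show "l \<in> fixed_vectors \<rho> K" by (simp add: fixed_vectors_def)
qed

section \<open>Double cosets and weak limits\<close>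

context group
begin

lemma mem_double_coset: "subgroup K G \<Longrightarrow> g \<in> carrier G \<Longrightarrow> g \<in> double_coset G K g"
  unfolding double_coset_def using subgroup.one_closed[of K G] by force

text \<open>One inclusion absorbs \<open>x\<close> and \<open>y\<close> into the outer factors. The
  other is the same inclusion applied to the translated element with the inverses of
  \<open>x\<close> and \<open>y\<close>.\<close>

lemma double_coset_translate:
  assumes K: "subgroup K G" and g: "g \<in> carrier G" and xy: "x \<in> K" "y \<in> K"
  shows "double_coset G K (x \<otimes> g \<otimes> y) = double_coset G K g"
proof -
  have sub: "double_coset G K (a \<otimes> h \<otimes> b) \<subseteq> double_coset G K h"
    if "h \<in> carrier G" "a \<in> K" "b \<in> K" for a b h
  proof
    fix z assume "z \<in> double_coset G K (a \<otimes> h \<otimes> b)"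
    then obtain c d where cd: "c \<in> K" "d \<in> K" "z = c \<otimes> (a \<otimes> h \<otimes> b) \<otimes> d"
      by (auto simp: double_coset_def)
    then have "z = (c \<otimes> a) \<otimes> h \<otimes> (b \<otimes> d)"
      using that subgroup.mem_carrier[OF K] by (simp add: m_assoc)
    then show "z \<in> double_coset G K h"
      using cd that subgroup.m_closed[OF K] by (auto simp: double_coset_def)
  qed
  have c: "x \<in> carrier G" "y \<in> carrier G" using xy subgroup.mem_carrier[OF K] by auto
  have "inv x \<otimes> (x \<otimes> g \<otimes> y) \<otimes> inv y = g"
    using c g by (simp add: m_assoc inv_solve_left')
  then have "double_coset G K g \<subseteq> double_coset G K (x \<otimes> g \<otimes> y)"
    using sub[of "x \<otimes> g \<otimes> y" "inv x" "inv y"] c g xy subgroup.m_inv_closed[OF K] by simp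
  then show ?thesis using sub[OF g xy] by blast
qed

section \<open>A unitary representation and the projection onto its \<open>K\<close>-fixed
  vectors\<close>

context
  fixes \<rho> :: "'a \<Rightarrow> 'h::complex_hilbert \<Rightarrow> 'h" and K :: "'a set"
  assumes rep: "unitary_rep G \<rho>" and K: "subgroup K G"
begin

abbreviation "HK \<equiv> fixed_vectors \<rho> K"
abbreviation "PK \<equiv> orthogonal_projection HK"

lemma rep_mult: "g \<in> carrier G \<Longrightarrow> h \<in> carrier G \<Longrightarrow> \<rho> (g \<otimes> h) v = \<rho> g (\<rho> h v)"
  using rep by (simp add: unitary_rep_def)

lemma rep_unitary: "g \<in> carrier G \<Longrightarrow> unitary_operator (\<rho> g)"
  using rep by (simp add: unitary_rep_def)

lemma rep_inv: "g \<in> carrier G \<Longrightarrow> \<rho> (inv g) (\<rho> g v) = v" "g \<in> carrier G \<Longrightarrow> \<rho> g (\<rho> (inv g) v) = v"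
  using rep rep_mult[of "inv g" g v] rep_mult[of g "inv g" v] by (simp_all add: unitary_rep_def)

lemma rep_adjoint: "g \<in> carrier G \<Longrightarrow> cinner (\<rho> g v) w = cinner v (\<rho> (inv g) w)"
  using unitary_operatorD(3)[OF rep_unitary, of g v "\<rho> (inv g) w"] by (simp add: rep_inv)

lemma csubspace_HK: "csubspace HK" and closed_HK: "closed HK"
  using rep_unitary subgroup.mem_carrier[OF K]
  by (auto intro!: csubspace_fixed_vectors closed_fixed_vectors)

lemmas PK_in = orthogonal_projection_in[OF csubspace_HK closed_HK]
  and PK_orth = orthogonal_projection_orth[OF csubspace_HK closed_HK]
  and PK_eqI = orthogonal_projection_eqI[OF csubspace_HK closed_HK]

lemma fixed: "v \<in> HK \<Longrightarrow> u \<in> K \<Longrightarrow> \<rho> u v = v"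
  by (simp add: fixed_vectors_def)

text \<open>Against a \<open>K\<close>-fixed vector \<open>z\<close>, the operator
  \<open>\<rho> u\<close> can be moved to the other side, where it disappears. So
  \<open>PK v\<close> already has the defining property of the projection of
  \<open>\<rho> u v\<close>.\<close>

lemma PK_rep:
  assumes u: "u \<in> K"
  shows "PK (\<rho> u v) = PK v"
proof (rule PK_eqI[OF PK_in])
  fix z assume z: "z \<in> HK"
  have c: "u \<in> carrier G" using u subgroup.mem_carrier[OF K] by blast
  have "cinner (\<rho> u v) z = cinner v z"
    using rep_adjoint[OF c] fixed[OF z subgroup.m_inv_closed[OF K u]] by simp
  then show "cinner (\<rho> u v - PK v) z = 0"
    using PK_orth[OF z, of v] by (simp add: cinner_diff_left)
qed

lemma rho_bar_translate:
  assumes g: "g \<in> carrier G" and xy: "x \<in> K" "y \<in> K"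
  shows "rho_bar \<rho> K (x \<otimes> g \<otimes> y) = rho_bar \<rho> K g"
proof -
  have c: "x \<in> carrier G" "y \<in> carrier G" using xy subgroup.mem_carrier[OF K] by auto
  have "PK (\<rho> (x \<otimes> g \<otimes> y) v) = PK (\<rho> g v)" if "v \<in> HK" for v
    using that c g xy by (simp add: rep_mult PK_rep fixed)
  then show ?thesis unfolding rho_bar_def by (rule restrict_ext)
qed

text \<open>Makes the definite description in \<open>rho_bar_dc\<close> usable:
  \<open>rho_bar\<close> is constant on the double coset, which contains \<open>g\<close> and so
  determines the operator.\<close>

lemma rho_bar_dc:
  assumes g: "g \<in> carrier G"
  shows "rho_bar_dc \<rho> K (double_coset G K g) = rho_bar \<rho> K g"
  unfolding rho_bar_dc_def
proof (rule the_equality)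
  show "\<forall>h\<in>double_coset G K g. rho_bar \<rho> K h = rho_bar \<rho> K g"
    using rho_bar_translate[OF g] by (auto simp: double_coset_def)
qed (use mem_double_coset[OF K g] in auto)

end

end

text \<open>
  Here \<open>K' m\<close> stands for the elements of \<open>K\<close> acting trivially on the first \<open>m\<close> coordinates.
\<close>

locale theta_system = group G for G (structure) +
  fixes K :: "'a set" and K' :: "nat \<Rightarrow> 'a set" and t :: "nat \<Rightarrow> 'a"
  assumes subgroup_K: "subgroup K G"
    and tail_subset: "K' m \<subseteq> K"
    and tail_antimono: "m \<le> n \<Longrightarrow> K' n \<subseteq> K' m"
    and t_in: "t N \<in> K"
    and tail_commute: "g \<in> carrier G \<Longrightarrow> \<exists>m. \<forall>u\<in>K' m. g \<otimes> u = u \<otimes> g"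
    and t_right: "u \<in> K \<Longrightarrow> \<exists>n. \<forall>N\<ge>n. \<exists>u'\<in>K' N. u \<otimes> t N = t N \<otimes> u'"
    and t_left: "u \<in> K \<Longrightarrow> \<exists>n. \<forall>N\<ge>n. \<exists>u'\<in>K' N. t N \<otimes> u = u' \<otimes> t N"
    and t_Suc: "m \<le> N \<Longrightarrow> \<exists>\<sigma>\<in>K' m. \<exists>\<tau>\<in>K' m. t (Suc N) = \<sigma> \<otimes> t N \<otimes> \<tau>"
begin

lemma K_carrier: "u \<in> K \<Longrightarrow> u \<in> carrier G"
  using subgroup.mem_carrier[OF subgroup_K] .

lemma tail_carrier: "u \<in> K' m \<Longrightarrow> u \<in> carrier G"
  using K_carrier tail_subset by blast

lemma t_carrier: "t N \<in> carrier G"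
  using K_carrier t_in by blast

abbreviation dc :: "'a \<Rightarrow> 'a set" where
  "dc \<equiv> double_coset G K"

lemma eventually_tail_commute:
  assumes "g \<in> carrier G"
  shows "\<forall>\<^sub>F N in sequentially. \<forall>u\<in>K' N. g \<otimes> u = u \<otimes> g"
  using tail_commute[OF assms] tail_antimono unfolding eventually_sequentially by blast

text \<open>The factor \<open>\<sigma>\<close> passes through \<open>g\<close> to the left and
  \<open>\<tau>\<close> through \<open>h\<close> to the right; both are then absorbed by the double
  coset.\<close>

lemma dc_t_Suc:
  assumes gh: "g \<in> carrier G" "h \<in> carrier G"
    and m: "\<forall>u\<in>K' m. g \<otimes> u = u \<otimes> g" "\<forall>u\<in>K' m. h \<otimes> u = u \<otimes> h" and "m \<le> N"
  shows "dc (g \<otimes> t (Suc N) \<otimes> h) = dc (g \<otimes> t N \<otimes> h)"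
proof -
  obtain \<sigma> \<tau> where st: "\<sigma> \<in> K' m" "\<tau> \<in> K' m" "t (Suc N) = \<sigma> \<otimes> t N \<otimes> \<tau>"
    using t_Suc[OF \<open>m \<le> N\<close>] by blast
  note c = gh tail_carrier[OF st(1)] tail_carrier[OF st(2)] t_carrier[of N]
  have "g \<otimes> t (Suc N) \<otimes> h = (g \<otimes> \<sigma>) \<otimes> t N \<otimes> (\<tau> \<otimes> h)"
    using c by (simp add: st(3) m_assoc)
  also have "\<dots> = (\<sigma> \<otimes> g) \<otimes> t N \<otimes> (h \<otimes> \<tau>)" using m st by simp
  also have "\<dots> = \<sigma> \<otimes> (g \<otimes> t N \<otimes> h) \<otimes> \<tau>" using c by (simp add: m_assoc)
  finally show ?thesis
    using double_coset_translate[OF subgroup_K, of "g \<otimes> t N \<otimes> h" \<sigma> \<tau>] c st tail_subset by auto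
qed

lemma dc_t_eventually_const:
  assumes gh: "g \<in> carrier G" "h \<in> carrier G"
  shows "\<exists>n. \<forall>N\<ge>n. dc (g \<otimes> t N \<otimes> h) = dc (g \<otimes> t n \<otimes> h)"
proof -
  obtain n where n: "\<forall>u\<in>K' n. g \<otimes> u = u \<otimes> g" "\<forall>u\<in>K' n. h \<otimes> u = u \<otimes> h"
    using eventually_conj[OF gh[THEN eventually_tail_commute]]
    by (auto simp: eventually_sequentially)
  have "dc (g \<otimes> t N \<otimes> h) = dc (g \<otimes> t n \<otimes> h)" if "n \<le> N" for N
    using that by (induction N rule: dec_induct) (use dc_t_Suc[OF gh n] in auto)
  then show ?thesis by blast
qed

text \<open>Independence of representatives. For large \<open>N\<close> the inner factors
  \<open>y\<close> and \<open>x'\<close> become tail elements on the opposite sides of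
  \<open>t N\<close>; these commute past \<open>g\<close> and \<open>h\<close> and are
  absorbed.\<close>

lemma dc_t_translate:
  assumes gh: "g \<in> carrier G" "h \<in> carrier G" and xy: "x \<in> K" "y \<in> K" "x' \<in> K" "y' \<in> K"
  shows "\<forall>\<^sub>F N in sequentially.
    dc ((x \<otimes> g \<otimes> y) \<otimes> t N \<otimes> (x' \<otimes> h \<otimes> y')) = dc (g \<otimes> t N \<otimes> h)"
proof -
  note cK = K_carrier[OF xy(1)] K_carrier[OF xy(2)] K_carrier[OF xy(3)] K_carrier[OF xy(4)]
  have "\<forall>\<^sub>F N in sequentially. \<exists>u'\<in>K' N. y \<otimes> t N = t N \<otimes> u'"
    "\<forall>\<^sub>F N in sequentially. \<exists>u'\<in>K' N. t N \<otimes> x' = u' \<otimes> t N"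
    using t_right[OF xy(2)] t_left[OF xy(3)] by (simp_all add: eventually_sequentially)
  then show ?thesis
    using eventually_tail_commute[OF gh(1)] eventually_tail_commute[OF gh(2)]
      \<comment> \<open>The factor \<open>y\<close> must commute with the tail element produced by
        \<open>x'\<close>, so that both can be moved across \<open>t N\<close>.\<close>
      eventually_tail_commute[OF cK(2)]
  proof eventually_elim
    case (elim N)
    obtain a where a: "a \<in> K' N" "y \<otimes> t N = t N \<otimes> a" using elim by blast
    obtain b where b: "b \<in> K' N" "t N \<otimes> x' = b \<otimes> t N" using elim by blast
    note c = gh cK tail_carrier[OF a(1)] tail_carrier[OF b(1)] t_carrier[of N]
    have 1: "y \<otimes> t N \<otimes> x' = b \<otimes> t N \<otimes> a"
    proof -
      have "y \<otimes> t N \<otimes> x' = (y \<otimes> b) \<otimes> t N" using c b by (simp add: m_assoc)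
      also have "\<dots> = b \<otimes> (y \<otimes> t N)" using c b elim by (simp add: m_assoc)
      finally show ?thesis using c a by (simp add: m_assoc)
    qed
    have "(x \<otimes> g \<otimes> y) \<otimes> t N \<otimes> (x' \<otimes> h \<otimes> y') = x \<otimes> (g \<otimes> (y \<otimes> t N \<otimes> x') \<otimes> h) \<otimes> y'"
      using c by (simp add: m_assoc)
    also have "\<dots> = x \<otimes> ((g \<otimes> b) \<otimes> t N \<otimes> (a \<otimes> h)) \<otimes> y'"
      unfolding 1 using c by (simp add: m_assoc)
    also have "\<dots> = x \<otimes> ((b \<otimes> g) \<otimes> t N \<otimes> (h \<otimes> a)) \<otimes> y'"
      using elim a b by simp
    also have "\<dots> = (x \<otimes> b) \<otimes> (g \<otimes> t N \<otimes> h) \<otimes> (a \<otimes> y')"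
      using c by (simp add: m_assoc)
    finally show ?case
      using double_coset_translate[OF subgroup_K, of "g \<otimes> t N \<otimes> h" "x \<otimes> b" "a \<otimes> y'"] c
        xy a b tail_subset[of N] subgroup.m_closed[OF subgroup_K] by auto
  qed
qed

text \<open>The definite description is the one in \<open>dc_star\<close>. Existence combines
  eventual constancy with independence of representatives; uniqueness holds because two eventual
  values of one sequence agree.\<close>

lemma star_eq:
  assumes gh: "g \<in> carrier G" "h \<in> carrier G"
  shows "\<forall>\<^sub>F N in sequentially.
    (THE d. \<forall>a\<in>dc g. \<forall>b\<in>dc h. \<forall>\<^sub>F N in sequentially. dc (a \<otimes> t N \<otimes> b) = d) = dc (g \<otimes> t N \<otimes> h)"
proof -
  obtain n where n: "\<forall>N\<ge>n. dc (g \<otimes> t N \<otimes> h) = dc (g \<otimes> t n \<otimes> h)"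
    using dc_t_eventually_const[OF gh] by blast
  define d where "d = dc (g \<otimes> t n \<otimes> h)"
  have ev: "\<forall>\<^sub>F N in sequentially. dc (g \<otimes> t N \<otimes> h) = d"
    unfolding eventually_sequentially d_def using n by blast
  have "(THE d. \<forall>a\<in>dc g. \<forall>b\<in>dc h. \<forall>\<^sub>F N in sequentially. dc (a \<otimes> t N \<otimes> b) = d) = d"
  proof (rule the_equality)
    show "\<forall>a\<in>dc g. \<forall>b\<in>dc h. \<forall>\<^sub>F N in sequentially. dc (a \<otimes> t N \<otimes> b) = d"
    proof (intro ballI)
      fix a b assume "a \<in> dc g" "b \<in> dc h"
      then obtain x y x' y' where *: "x \<in> K" "y \<in> K" "x' \<in> K" "y' \<in> K"
        "a = x \<otimes> g \<otimes> y" "b = x' \<otimes> h \<otimes> y'" unfolding double_coset_def by blast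
      from dc_t_translate[OF gh *(1-4)] ev
      show "\<forall>\<^sub>F N in sequentially. dc (a \<otimes> t N \<otimes> b) = d"
        by eventually_elim (simp add: *)
    qed
  next
    fix d' assume "\<forall>a\<in>dc g. \<forall>b\<in>dc h. \<forall>\<^sub>F N in sequentially. dc (a \<otimes> t N \<otimes> b) = d'"
    then have "\<forall>\<^sub>F N in sequentially. dc (g \<otimes> t N \<otimes> h) = d'"
      using mem_double_coset[OF subgroup_K] gh by blast
    with ev have "\<forall>\<^sub>F N in sequentially. d' = d" by eventually_elim simp
    then show "d' = d" by simp
  qed
  then show ?thesis using ev by (auto elim: eventually_mono)
qed

text \<open>Let \<open>E\<close> be the closed subspace of test vectors on which the limit is
  correct. It contains the \<open>K\<close>-fixed vectors and all \<open>\<rho> u f - f\<close>. A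
  vector orthogonal to \<open>E\<close> is therefore \<open>K\<close>-fixed, lies in
  \<open>E\<close> and vanishes, so \<open>E\<close> is the whole space.\<close>

lemma t_weak_limit:
  fixes \<rho> :: "'a \<Rightarrow> 'h::complex_hilbert \<Rightarrow> 'h"
  assumes rep: "unitary_rep G \<rho>" and w: "w \<in> fixed_vectors \<rho> (K' m)"
  shows "(\<lambda>N. cinner (\<rho> (t N) w) x) \<longlonglongrightarrow> cinner (orthogonal_projection (fixed_vectors \<rho> K) w) x"
proof -
  let ?H = "fixed_vectors \<rho> K"
  define Pw where "Pw = orthogonal_projection ?H w"
  have PwH: "Pw \<in> ?H" using PK_in[OF rep subgroup_K] by (simp add: Pw_def)
  define E where "E = {x. (\<lambda>N. cinner (\<rho> (t N) w - Pw) x) \<longlonglongrightarrow> 0}"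
  have sub: "csubspace E" unfolding E_def by (rule csubspace_cinner_tendsto_0)
  have cl: "closed E" unfolding E_def
  proof (rule closed_cinner_tendsto_0)
    fix N show "norm (\<rho> (t N) w - Pw) \<le> norm w + norm Pw"
      using norm_triangle_ineq4[of "\<rho> (t N) w" Pw]
      by (simp add: unitary_operatorD(4)[OF rep_unitary[OF rep subgroup_K t_carrier]])
  qed
  \<comment> \<open>Since \<open>t N\<close> lies in \<open>K\<close>, its inverse fixes
    \<open>z\<close>, so the pairing of \<open>\<rho> (t N) w\<close> with \<open>z\<close> is that
    of \<open>w\<close>, hence that of \<open>Pw\<close>.\<close>
  have HE: "z \<in> E" if z: "z \<in> ?H" for z
  proof -
    have "cinner (\<rho> (t N) w - Pw) z = 0" for N
      using rep_adjoint[OF rep subgroup_K t_carrier, of N w z]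
        fixed[OF rep subgroup_K z subgroup.m_inv_closed[OF subgroup_K t_in]]
        PK_orth[OF rep subgroup_K z, of w]
      by (simp add: cinner_diff_left Pw_def)
    then show ?thesis by (simp add: E_def)
  qed
  have dE: "\<rho> u f - f \<in> E" if u: "u \<in> K" for u f
  proof -
    have ui: "inv u \<in> K" using subgroup.m_inv_closed[OF subgroup_K u] .
    obtain n where n: "\<And>N. N \<ge> n \<Longrightarrow> \<exists>u'\<in>K' N. inv u \<otimes> t N = t N \<otimes> u'"
      using t_right[OF ui] by blast
    \<comment> \<open>The bound \<open>n\<close> supplies the tail element \<open>u'\<close>; the
      bound \<open>m\<close> ensures that \<open>u'\<close> fixes \<open>w\<close>. Then
      \<open>inv u\<close> fixes \<open>\<rho> (t N) w - Pw\<close>, and adjointness makes its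
      pairings with \<open>\<rho> u f\<close> and \<open>f\<close> equal.\<close>
    have "cinner (\<rho> (t N) w - Pw) (\<rho> u f - f) = 0" if N: "N \<ge> max m n" for N
    proof -
      obtain u' where u': "u' \<in> K' N" "inv u \<otimes> t N = t N \<otimes> u'" using n[of N] N by auto
      have "u' \<in> K' m" using u' N tail_antimono[of m N] by auto
      have "\<rho> (inv u) (\<rho> (t N) w) = \<rho> (t N) (\<rho> u' w)"
        using rep_mult[OF rep subgroup_K] K_carrier[OF ui] tail_carrier[OF u'(1)] t_carrier u'(2)
        by metis
      also have "\<rho> u' w = w" using w \<open>u' \<in> K' m\<close> by (simp add: fixed_vectors_def)
      finally have "\<rho> (inv u) (\<rho> (t N) w - Pw) = \<rho> (t N) w - Pw"
        using unitary_operatorD(5)[OF rep_unitary[OF rep subgroup_K K_carrier[OF ui]]]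
          fixed[OF rep subgroup_K PwH ui] by simp
      then show ?thesis
        using rep_adjoint[OF rep subgroup_K K_carrier[OF ui], of "\<rho> (t N) w - Pw" f] K_carrier[OF u]
        by (simp add: cinner_diff_right)
    qed
    then have "\<forall>\<^sub>F N in sequentially. cinner (\<rho> (t N) w - Pw) (\<rho> u f - f) = 0"
      unfolding eventually_sequentially by blast
    then show ?thesis unfolding E_def by (simp add: tendsto_eventually)
  qed
  \<comment> \<open>Split \<open>x\<close> into its part in \<open>E\<close> and the residue
    \<open>f\<close> orthogonal to \<open>E\<close>; the aim is \<open>f = 0\<close>.\<close>
  define e where "e = orthogonal_projection E x"
  define f where "f = x - e"
  have eE: "e \<in> E" using orthogonal_projection_in[OF sub cl] by (simp add: e_def)
  have f_orth: "cinner f z = 0" if "z \<in> E" for z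
    using orthogonal_projection_orth[OF sub cl that] by (simp add: e_def f_def)
  \<comment> \<open>Orthogonality to \<open>\<rho> u f - f\<close> gives
    \<open>cinner f (\<rho> u f) = cinner f f\<close>. As \<open>\<rho> u\<close> preserves norms,
    expanding the squared norm of \<open>\<rho> u f - f\<close> gives zero.\<close>
  have "\<rho> u f = f" if u: "u \<in> K" for u
  proof -
    note U = unitary_operatorD(3)[OF rep_unitary[OF rep subgroup_K K_carrier[OF u]], of f f]
    have "cinner f (\<rho> u f) = cinner f f"
      using f_orth[OF dE[OF u, of f]] by (simp add: cinner_diff_right)
    moreover have "cinner (\<rho> u f) f = cinner f f"
      using \<open>cinner f (\<rho> u f) = cinner f f\<close> cinner_commute by metis
    ultimately have "cinner (\<rho> u f - f) (\<rho> u f - f) = 0"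
      using U by (simp add: cinner_diff_left cinner_diff_right)
    then show ?thesis by (simp add: cinner_self)
  qed
  then have "f \<in> E" using HE by (auto simp: fixed_vectors_def)
  then have "f = 0" using f_orth[of f] by (simp add: cinner_self)
  then have "x \<in> E" using eE by (simp add: f_def)
  then have "(\<lambda>N. cinner (\<rho> (t N) w) x - cinner Pw x) \<longlonglongrightarrow> 0"
    by (simp add: E_def cinner_diff_left)
  then show ?thesis by (simp add: LIM_zero_iff Pw_def)
qed

text \<open>The right-hand operator is identified through \<open>PK_eqI\<close>: its pairings with
  \<open>K\<close>-fixed vectors are the eventual values of the coefficients of
  \<open>\<rho> (g \<otimes> t N \<otimes> h)\<close>, while the weak limit computes the same
  coefficients for the composition.\<close>

lemma rho_bar_star:
  fixes \<rho> :: "'a \<Rightarrow> 'h::complex_hilbert \<Rightarrow> 'h"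
  assumes rep: "unitary_rep G \<rho>" and gh: "g \<in> carrier G" "h \<in> carrier G"
  shows "compose (fixed_vectors \<rho> K) (rho_bar_dc \<rho> K (dc g)) (rho_bar_dc \<rho> K (dc h)) =
    rho_bar_dc \<rho> K (THE d. \<forall>a\<in>dc g. \<forall>b\<in>dc h. \<forall>\<^sub>F N in sequentially. dc (a \<otimes> t N \<otimes> b) = d)"
    (is "_ = rho_bar_dc \<rho> K ?d")
proof -
  let ?H = "fixed_vectors \<rho> K" and ?P = "orthogonal_projection (fixed_vectors \<rho> K)"
  note mult = rep_mult[OF rep subgroup_K]
  have c: "g \<otimes> t N \<otimes> h \<in> carrier G" for N using gh t_carrier by simp
  have ev: "\<forall>\<^sub>F N in sequentially. rho_bar_dc \<rho> K ?d = rho_bar \<rho> K (g \<otimes> t N \<otimes> h)"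
    using star_eq[OF gh] by eventually_elim (simp add: rho_bar_dc[OF rep subgroup_K c])
  \<comment> \<open>One representative suffices to see that the right-hand operator takes values in
    the fixed vectors and is \<open>undefined\<close> off them.\<close>
  then obtain n where n: "rho_bar_dc \<rho> K ?d = rho_bar \<rho> K (g \<otimes> t n \<otimes> h)"
    by (auto simp: eventually_sequentially)
  obtain m where m: "\<forall>u\<in>K' m. h \<otimes> u = u \<otimes> h" using tail_commute[OF gh(2)] by blast
  have "?P (\<rho> g (?P (\<rho> h v))) = rho_bar_dc \<rho> K ?d v" if v: "v \<in> ?H" for v
  proof (rule PK_eqI[OF rep subgroup_K])
    show "rho_bar_dc \<rho> K ?d v \<in> ?H"
      using v PK_in[OF rep subgroup_K] by (simp add: n rho_bar_def)
    fix z assume z: "z \<in> ?H"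
    have "\<rho> u (\<rho> h v) = \<rho> h v" if "u \<in> K' m" for u
    proof -
      have "\<rho> u (\<rho> h v) = \<rho> h (\<rho> u v)"
        using mult[of u h v] mult[of h u v] gh tail_carrier[OF that] m that by simp
      then show ?thesis
        using fixed[OF rep subgroup_K v] that tail_subset by (metis subsetD)
    qed
    then have "\<rho> h v \<in> fixed_vectors \<rho> (K' m)" by (simp add: fixed_vectors_def)
    \<comment> \<open>Testing against \<open>\<rho> (inv g) z\<close> carries the factor
      \<open>\<rho> g\<close> over to the first argument.\<close>
    from t_weak_limit[OF rep this, of "\<rho> (inv g) z"]
    have "(\<lambda>N. cinner (\<rho> (g \<otimes> t N \<otimes> h) v) z) \<longlonglongrightarrow> cinner (\<rho> g (?P (\<rho> h v))) z"
      using gh t_carrier by (simp add: mult rep_adjoint[OF rep subgroup_K gh(1)])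
    moreover have "\<forall>\<^sub>F N in sequentially.
      cinner (\<rho> (g \<otimes> t N \<otimes> h) v) z = cinner (rho_bar_dc \<rho> K ?d v) z"
      using ev
    proof eventually_elim
      case (elim N)
      then show ?case
        using v PK_orth[OF rep subgroup_K z, of "\<rho> (g \<otimes> t N \<otimes> h) v"]
        by (simp add: rho_bar_def cinner_diff_left)
    qed
    ultimately have "cinner (\<rho> g (?P (\<rho> h v))) z = cinner (rho_bar_dc \<rho> K ?d v) z"
      by (rule LIMSEQ_unique[OF _ tendsto_eventually])
    then show "cinner (\<rho> g (?P (\<rho> h v)) - rho_bar_dc \<rho> K ?d v) z = 0"
      by (simp add: cinner_diff_left)
  qed
  then show ?thesis
    using PK_in[OF rep subgroup_K]
    by (auto simp: fun_eq_iff compose_def n rho_bar_dc[OF rep subgroup_K] gh rho_bar_def)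
qed

end

section \<open>Finitary matrices\<close>

text \<open>Replaces \<open>Sum_any\<close> by an ordinary finite sum over any convenient set
  containing the support.\<close>

lemma mat_mult_eq_sum:
  assumes "finite F" "\<And>l. A i l \<noteq> 0 \<Longrightarrow> B l j \<noteq> 0 \<Longrightarrow> l \<in> F"
  shows "mat_mult A B i j = (\<Sum>l\<in>F. A i l * B l j)"
  unfolding mat_mult_def
proof (rule Sum_any.expand_superset[OF assms(1)])
  have "A i l \<noteq> 0 \<and> B l j \<noteq> 0" if "A i l * B l j \<noteq> 0" for l
    using that by auto
  then show "{l. A i l * B l j \<noteq> 0} \<subseteq> F" using assms(2) by blast
qed

lemma mat_mult_row_one:
  fixes B :: "('i, 'a::semiring_1) matrix"
  assumes "\<And>l. A i l = mat_one I i l"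
  shows "mat_mult A B i j = (if i \<in> I then B i j else 0)"
proof -
  have "mat_mult A B i j = (\<Sum>l\<in>{i}. A i l * B l j)"
    by (rule mat_mult_eq_sum) (auto simp: assms mat_one_def split: if_splits)
  then show ?thesis by (simp add: assms mat_one_def)
qed

lemma mat_mult_column_one:
  fixes B :: "('i, 'a::semiring_1) matrix"
  assumes "\<And>l. B l j = mat_one I l j"
  shows "mat_mult A B i j = (if j \<in> I then A i j else 0)"
proof -
  have "mat_mult A B i j = (\<Sum>l\<in>{j}. A i l * B l j)"
    by (rule mat_mult_eq_sum) (auto simp: assms mat_one_def split: if_splits)
  then show ?thesis by (simp add: assms mat_one_def)
qed

text \<open>Refines \<open>finitary\<close> by recording the block \<open>S\<close> in which the
  matrix may differ from the unit matrix. The set \<open>S\<close> may be infinite, so the same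
  notion describes tails.\<close>

definition one_outside :: "'i set \<Rightarrow> 'i set \<Rightarrow> ('i, 'a::zero_neq_one) matrix \<Rightarrow> bool" where
  "one_outside I S A \<longleftrightarrow> (\<forall>i j. (i \<in> I \<and> j \<in> I) \<or> A i j = 0) \<and>
     (\<forall>i j. (i \<in> S \<and> j \<in> S) \<or> A i j = mat_one I i j)"

lemma one_outside_zero: "one_outside I S A \<Longrightarrow> i \<notin> I \<or> j \<notin> I \<Longrightarrow> A i j = 0"
  by (auto simp: one_outside_def)

lemma one_outside_one: "one_outside I S A \<Longrightarrow> i \<notin> S \<or> j \<notin> S \<Longrightarrow> A i j = mat_one I i j"
  by (auto simp: one_outside_def)

lemma one_outside_mono: "one_outside I S A \<Longrightarrow> S \<subseteq> T \<Longrightarrow> one_outside I T A"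
  unfolding one_outside_def by blast

text \<open>For \<open>S\<close> take all row and column indices of entries that differ from the
  unit matrix.\<close>

lemma finitary_iff_one_outside: "finitary I A \<longleftrightarrow> (\<exists>S. finite S \<and> one_outside I S A)"
proof
  assume A: "finitary I A"
  let ?D = "{(i, j). A i j \<noteq> mat_one I i j}"
  have "i \<in> fst ` ?D \<union> snd ` ?D \<and> j \<in> fst ` ?D \<union> snd ` ?D" if "A i j \<noteq> mat_one I i j" for i j
    using that by force
  then have "one_outside I (fst ` ?D \<union> snd ` ?D) A"
    using A unfolding one_outside_def finitary_def by blast
  moreover have "finite (fst ` ?D \<union> snd ` ?D)" using A by (simp add: finitary_def)
  ultimately show "\<exists>S. finite S \<and> one_outside I S A" by blast
next
  assume "\<exists>S. finite S \<and> one_outside I S A"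
  then obtain S where S: "finite S" "one_outside I S A" by blast
  then have "{(i, j). A i j \<noteq> mat_one I i j} \<subseteq> S \<times> S" by (auto simp: one_outside_def)
  then have "finite {(i, j). A i j \<noteq> mat_one I i j}" using S(1) by (simp add: finite_subset)
  then show "finitary I A" using S by (auto simp: finitary_def one_outside_def)
qed

lemma finite_row: "finitary I A \<Longrightarrow> finite {l. A i l \<noteq> 0}"
proof -
  assume "finitary I A"
  then obtain S where S: "finite S" "one_outside I S A" by (auto simp: finitary_iff_one_outside)
  then have "{l. A i l \<noteq> 0} \<subseteq> insert i S" by (auto simp: one_outside_def mat_one_def split: if_splits)
  then show ?thesis using S(1) by (simp add: finite_subset)
qed

lemma finite_column: "finitary I A \<Longrightarrow> finite {l. A l j \<noteq> 0}"
proof -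
  assume "finitary I A"
  then obtain S where S: "finite S" "one_outside I S A" by (auto simp: finitary_iff_one_outside)
  then have "{l. A l j \<noteq> 0} \<subseteq> insert j S" by (auto simp: one_outside_def mat_one_def split: if_splits)
  then show ?thesis using S(1) by (simp add: finite_subset)
qed

lemma one_outside_mat_one: "one_outside I S (mat_one I)"
  by (auto simp: one_outside_def mat_one_def)

lemma finitary_mat_one: "finitary I (mat_one I)"
  using one_outside_mat_one[of I "{}"] by (auto simp: finitary_iff_one_outside)

lemma mat_mult_one_left: "finitary I (B :: ('i, 'a::semiring_1) matrix) \<Longrightarrow> mat_mult (mat_one I) B = B"
  by (auto simp: fun_eq_iff mat_mult_row_one[where I = I] finitary_def)

lemma mat_mult_one_right: "finitary I (B :: ('i, 'a::semiring_1) matrix) \<Longrightarrow> mat_mult B (mat_one I) = B"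
  by (auto simp: fun_eq_iff mat_mult_column_one[where I = I] finitary_def)

text \<open>For a row index off \<open>S\<close> the row of the product is that of \<open>B\<close>;
  for a column index off \<open>S\<close> its column is that of \<open>A\<close>.\<close>

lemma one_outside_mat_mult:
  fixes A B :: "('i, 'a::semiring_1) matrix"
  assumes A: "one_outside I S A" and B: "one_outside I S B"
  shows "one_outside I S (mat_mult A B)"
proof -
  have "mat_mult A B i j = 0" if "i \<notin> I \<or> j \<notin> I" for i j
    using that one_outside_zero[OF A] one_outside_zero[OF B]
    by (subst mat_mult_eq_sum[where F = "{}"]) auto
  moreover have "mat_mult A B i j = mat_one I i j" if "i \<notin> S \<or> j \<notin> S" for i j
  proof (cases "i \<in> S")
    case False
    then have "mat_mult A B i j = (if i \<in> I then B i j else 0)"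
      by (intro mat_mult_row_one one_outside_one[OF A]) simp
    then show ?thesis using False one_outside_one[OF B, of i j] by (auto simp: mat_one_def)
  next
    case True
    then have j: "j \<notin> S" using that by simp
    then have "mat_mult A B i j = (if j \<in> I then A i j else 0)"
      by (intro mat_mult_column_one one_outside_one[OF B]) simp
    then show ?thesis using j one_outside_one[OF A, of i j] by (auto simp: mat_one_def)
  qed
  ultimately show ?thesis unfolding one_outside_def by blast
qed

lemma finitary_mat_mult:
  fixes A B :: "('i, 'a::semiring_1) matrix"
  assumes "finitary I A" "finitary I B"
  shows "finitary I (mat_mult A B)"
proof -
  obtain S T where "finite S" "one_outside I S A" "finite T" "one_outside I T B"
    using assms by (auto simp: finitary_iff_one_outside)
  then have "finite (S \<union> T)" "one_outside I (S \<union> T) (mat_mult A B)"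
    by (auto intro: one_outside_mat_mult one_outside_mono)
  then show ?thesis unfolding finitary_iff_one_outside by blast
qed

text \<open>Finite rows of \<open>A\<close> and finite columns of \<open>C\<close> turn both
  bracketings into the same finite double sum.\<close>

lemma mat_mult_assoc:
  fixes A B C :: "('i, 'a::semiring_0) matrix"
  assumes rows: "\<And>i. finite {l. A i l \<noteq> 0}" and columns: "\<And>j. finite {l. C l j \<noteq> 0}"
  shows "mat_mult (mat_mult A B) C = mat_mult A (mat_mult B C)"
proof (intro ext)
  fix i j
  let ?F = "{l. A i l \<noteq> 0}" and ?E = "{l. C l j \<noteq> 0}"
  have "mat_mult (mat_mult A B) C i j = (\<Sum>l\<in>?E. mat_mult A B i l * C l j)"
    by (rule mat_mult_eq_sum[OF columns]) simp
  also have "\<dots> = (\<Sum>l\<in>?E. \<Sum>m\<in>?F. A i m * B m l * C l j)"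
    by (simp add: mat_mult_eq_sum[OF rows] sum_distrib_right)
  also have "\<dots> = (\<Sum>m\<in>?F. \<Sum>l\<in>?E. A i m * (B m l * C l j))"
    by (subst sum.swap) (simp add: mult.assoc)
  also have "\<dots> = (\<Sum>m\<in>?F. A i m * mat_mult B C m j)"
    by (simp add: mat_mult_eq_sum[OF columns] sum_distrib_left)
  also have "\<dots> = mat_mult A (mat_mult B C) i j"
    by (rule mat_mult_eq_sum[OF rows, symmetric]) simp
  finally show "mat_mult (mat_mult A B) C i j = mat_mult A (mat_mult B C) i j" .
qed

lemma finitary_mat_mult_assoc:
  fixes A B C :: "('i, 'a::semiring_1) matrix"
  assumes "finitary I A" "finitary I C"
  shows "mat_mult (mat_mult A B) C = mat_mult A (mat_mult B C)"
  by (rule mat_mult_assoc[OF finite_row[OF assms(1)] finite_column[OF assms(2)]])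

text \<open>Cancels adjacent inverse factors once products are bracketed to the right, as needed for
  the inverse of a product.\<close>

lemma mat_mult_cancel_left:
  fixes A B C :: "('i, 'a::semiring_1) matrix"
  assumes "finitary I A" "finitary I C" "mat_mult A B = mat_one I"
  shows "mat_mult A (mat_mult B C) = C"
  using assms by (simp add: mat_mult_one_left flip: finitary_mat_mult_assoc)

lemma group_GL_fin: "group (GL_fin I :: ('i, 'a::field) matrix monoid)"
proof (rule groupI)
  fix A B :: "('i, 'a) matrix"
  assume "A \<in> carrier (GL_fin I)" "B \<in> carrier (GL_fin I)"
  then obtain A' B' where AB: "finitary I A" "finitary I B" "finitary I A'" "finitary I B'"
    "mat_mult A A' = mat_one I" "mat_mult A' A = mat_one I"
    "mat_mult B B' = mat_one I" "mat_mult B' B = mat_one I"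
    by (auto simp: GL_fin_def)
  have inv: "mat_mult (mat_mult X Y) (mat_mult Y' X') = mat_one I"
    if "finitary I X" "finitary I Y" "finitary I X'" "finitary I Y'"
      "mat_mult X X' = mat_one I" "mat_mult Y Y' = mat_one I"
    for X Y X' Y' :: "('i, 'a) matrix"
    using that
    by (simp add: finitary_mat_mult_assoc[of I] mat_mult_cancel_left[of I] finitary_mat_mult)
  have "mat_mult (mat_mult A B) (mat_mult B' A') = mat_one I"
    "mat_mult (mat_mult B' A') (mat_mult A B) = mat_one I"
    using AB inv by blast+
  moreover have "finitary I (mat_mult A B)" "finitary I (mat_mult B' A')"
    using AB finitary_mat_mult by blast+
  ultimately show "A \<otimes>\<^bsub>GL_fin I\<^esub> B \<in> carrier (GL_fin I)"
    by (auto simp: GL_fin_def)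
next
  show "\<one>\<^bsub>GL_fin I\<^esub> \<in> carrier (GL_fin I :: ('i, 'a) matrix monoid)"
    using finitary_mat_one mat_mult_one_left by (force simp: GL_fin_def)
qed (auto simp: GL_fin_def mat_mult_one_left intro: finitary_mat_mult_assoc)

text \<open>In a row off \<open>S\<close> both products have the entries of \<open>B\<close>, in a
  row off \<open>T\<close> those of \<open>A\<close>. Disjointness puts every row in one of these
  cases.\<close>

lemma mat_mult_commute_one_outside:
  fixes A B :: "('i, 'a::semiring_1) matrix"
  assumes A: "one_outside I S A" and B: "one_outside I T B" and disj: "S \<inter> T = {}"
  shows "mat_mult A B = mat_mult B A"
proof -
  have entry: "mat_mult A B i j = B i j \<and> mat_mult B A i j = B i j"
    if A: "one_outside I S A" and B: "one_outside I T B" and disj: "S \<inter> T = {}" and i: "i \<notin> S"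
    for A B :: "('i, 'a) matrix" and S T i j
  proof
    have "mat_mult A B i j = (if i \<in> I then B i j else 0)"
      by (intro mat_mult_row_one one_outside_one[OF A]) (simp add: i)
    then show "mat_mult A B i j = B i j" using one_outside_zero[OF B] by simp
    \<comment> \<open>\<open>A l j\<close> can differ from the unit matrix only for \<open>l\<close>
      in \<open>S\<close>. Then \<open>l\<close> is off \<open>T\<close> and differs from
      \<open>i\<close>, so the factor \<open>B i l\<close> is an off-diagonal zero.\<close>
    have "B i l * A l j = B i l * mat_one I l j" for l
    proof (cases "l \<in> S \<and> j \<in> S")
      case True
      then have "l \<notin> T" "i \<noteq> l" using disj i by auto
      then have "B i l = 0"
        using one_outside_one[OF B, of i l] by (simp add: mat_one_def)
      then show ?thesis by simp
    qed (use one_outside_one[OF A] in auto)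
    then have "mat_mult B A i j = mat_mult B (mat_one I) i j" by (simp add: mat_mult_def)
    also have "\<dots> = (if j \<in> I then B i j else 0)" by (intro mat_mult_column_one) simp
    finally show "mat_mult B A i j = B i j" using one_outside_zero[OF B] by simp
  qed
  have disj': "T \<inter> S = {}" using disj by blast
  show ?thesis
  proof (intro ext)
    fix i j
    show "mat_mult A B i j = mat_mult B A i j"
      using entry[OF A B disj, of i j] entry[OF B A disj', of i j] disj
      by (cases "i \<in> S") (metis disjoint_iff)+
  qed
qed

lemma mat_transpose_mult:
  "mat_transpose (mat_mult A B :: ('i, 'a::comm_semiring_0) matrix) =
    mat_mult (mat_transpose B) (mat_transpose A)"
  by (simp add: fun_eq_iff mat_transpose_def mat_mult_def mult.commute)

lemma mat_transpose_transpose [simp]: "mat_transpose (mat_transpose A) = A"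
  by (simp add: fun_eq_iff mat_transpose_def)

lemma one_outside_transpose: "one_outside I S A \<Longrightarrow> one_outside I S (mat_transpose A)"
  unfolding one_outside_def mat_transpose_def mat_one_def by metis

lemma finitary_transpose: "finitary I A \<Longrightarrow> finitary I (mat_transpose A)"
  unfolding finitary_iff_one_outside using one_outside_transpose by blast

section \<open>Orthogonal matrices and the involutions \<open>\<Theta>\<^sub>N\<close>\<close>

lemma Zp_0: "0 \<in> Zp" and Zp_1: "1 \<in> Zp"
  by (auto simp: Zp_def Zero_fract_def One_fract_def)

lemma Zp_add: "x \<in> Zp \<Longrightarrow> y \<in> Zp \<Longrightarrow> x + y \<in> Zp"
  by (auto simp: Zp_def)

lemma Zp_mult: "x \<in> Zp \<Longrightarrow> y \<in> Zp \<Longrightarrow> x * y \<in> Zp"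
  by (auto simp: Zp_def)

lemma Zp_sum: "(\<And>i. i \<in> F \<Longrightarrow> f i \<in> Zp) \<Longrightarrow> sum f F \<in> Zp"
  by (induction F rule: infinite_finite_induct) (auto simp: Zp_0 Zp_add)

lemma O_inf_mult:
  assumes "u \<in> O_inf" "v \<in> O_inf"
  shows "mat_mult u v \<in> O_inf"
proof -
  have u: "finitary UNIV u" "\<And>i j. u i j \<in> Zp" "mat_mult u (mat_transpose u) = mat_one UNIV"
    "mat_mult (mat_transpose u) u = mat_one UNIV"
    and v: "finitary UNIV v" "\<And>i j. v i j \<in> Zp" "mat_mult v (mat_transpose v) = mat_one UNIV"
    "mat_mult (mat_transpose v) v = mat_one UNIV"
    using assms by (auto simp: O_inf_def)
  note fin = u(1) v(1) finitary_transpose[OF u(1)] finitary_transpose[OF v(1)]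
  have "mat_mult u v i j \<in> Zp" for i j
  proof -
    have "mat_mult u v i j = (\<Sum>l | u i l \<noteq> 0. u i l * v l j)"
      by (rule mat_mult_eq_sum[OF finite_row[OF u(1)]]) simp
    then show ?thesis using u v by (simp add: Zp_sum Zp_mult)
  qed
  moreover have "mat_mult (mat_mult u v) (mat_transpose (mat_mult u v)) = mat_one UNIV"
    "mat_mult (mat_transpose (mat_mult u v)) (mat_mult u v) = mat_one UNIV"
    using fin u v by (simp_all add: mat_transpose_mult finitary_mat_mult_assoc[of UNIV]
        mat_mult_cancel_left[of UNIV] finitary_mat_mult)
  ultimately show ?thesis
    using fin by (simp add: O_inf_def finitary_mat_mult)
qed

lemma O_inf_transpose: "u \<in> O_inf \<Longrightarrow> mat_transpose u \<in> O_inf"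
  by (simp add: O_inf_def finitary_transpose) (simp add: mat_transpose_def)

lemma O_inf_finitary: "u \<in> O_inf \<Longrightarrow> finitary UNIV u"
  by (simp add: O_inf_def)

section \<open>The block-diagonal embedding\<close>

lemma diag_embed_mult:
  fixes u v :: "(nat, 'a::semiring_1) matrix"
  assumes u: "finitary UNIV u"
  shows "diag_embed \<alpha> k (mat_mult u v) = mat_mult (diag_embed \<alpha> k u) (diag_embed \<alpha> k v)"
proof (intro ext)
  fix x y
  show "diag_embed \<alpha> k (mat_mult u v) x y = mat_mult (diag_embed \<alpha> k u) (diag_embed \<alpha> k v) x y"
  proof (cases x)
    case (Inl a)
    have "diag_embed \<alpha> k u (Inl a) l * diag_embed \<alpha> k v l y \<noteq> 0 \<Longrightarrow> l = Inl a" for l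
      by (cases l) (auto split: if_splits)
    then have "mat_mult (diag_embed \<alpha> k u) (diag_embed \<alpha> k v) x y =
        (\<Sum>l\<in>{Inl a}. diag_embed \<alpha> k u x l * diag_embed \<alpha> k v l y)"
      unfolding Inl mat_mult_def by (intro Sum_any.expand_superset) auto
    then show ?thesis using Inl by (cases y) auto
  next
    case (Inr p)
    obtain c i where p: "p = (c, i)" by (cases p)
    let ?F = "{l. u i l \<noteq> 0}"
    have F: "finite ?F" by (rule finite_row[OF u])
    \<comment> \<open>Row \<open>(c, i)\<close> of the embedded matrix is supported in the
      \<open>c\<close>-th block, at the support of row \<open>i\<close> of \<open>u\<close>.\<close>
    have *: "mat_mult (diag_embed \<alpha> k u) (diag_embed \<alpha> k v) x y =
        (\<Sum>l\<in>(\<lambda>l. Inr (c, l)) ` ?F. diag_embed \<alpha> k u x l * diag_embed \<alpha> k v l y)"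
      unfolding Inr p
    proof (rule mat_mult_eq_sum)
      fix l assume "diag_embed \<alpha> k u (Inr (c, i)) l \<noteq> 0"
      then show "l \<in> (\<lambda>l. Inr (c, l)) ` ?F" by (cases l) (auto split: if_splits)
    qed (use F in simp)
    also have "\<dots> = (\<Sum>l\<in>?F. diag_embed \<alpha> k u x (Inr (c, l)) * diag_embed \<alpha> k v (Inr (c, l)) y)"
      by (subst sum.reindex) (auto simp: inj_on_def)
    also have "\<dots> = diag_embed \<alpha> k (mat_mult u v) x y"
    proof (cases y)
      case (Inr q)
      moreover obtain d j where "q = (d, j)" by (cases q)
      moreover have "mat_mult u v i j = (\<Sum>l\<in>?F. u i l * v l j)"
        by (rule mat_mult_eq_sum[OF F]) simp
      ultimately show ?thesis using \<open>x = Inr p\<close> p by auto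
    qed (simp add: Inr p)
    finally show ?thesis ..
  qed
qed

lemma diag_embed_one: "diag_embed \<alpha> k (mat_one UNIV) = mat_one (block_indices \<alpha> k)"
proof (intro ext)
  fix x y
  show "diag_embed \<alpha> k (mat_one UNIV) x y = (mat_one (block_indices \<alpha> k) x y :: 'a)"
    by (cases "(\<alpha>, k, mat_one UNIV :: (nat, 'a) matrix, x, y)" rule: diag_embed.cases)
      (auto simp: mat_one_def block_indices_def)
qed

text \<open>The block \<open>S\<close> is repeated in each infinite block. With finite
  \<open>S\<close> this gives finitarity, with \<open>S = {m..}\<close> the commutation of tails
  with a given group element.\<close>

lemma one_outside_diag_embed:
  assumes "one_outside UNIV S u"
  shows "one_outside (block_indices \<alpha> k) (Inr ` ({..<k} \<times> S)) (diag_embed \<alpha> k u)"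
proof -
  have "(x \<in> block_indices \<alpha> k \<and> y \<in> block_indices \<alpha> k) \<or> diag_embed \<alpha> k u x y = 0" for x y
    by (cases "(\<alpha>, k, u, x, y)" rule: diag_embed.cases) (auto simp: block_indices_def)
  moreover have "(x \<in> Inr ` ({..<k} \<times> S) \<and> y \<in> Inr ` ({..<k} \<times> S)) \<or>
      diag_embed \<alpha> k u x y = mat_one (block_indices \<alpha> k) x y" for x y
    using assms unfolding one_outside_def
    by (cases "(\<alpha>, k, u, x, y)" rule: diag_embed.cases)
      (auto simp: block_indices_def mat_one_def split: if_splits)
  ultimately show ?thesis unfolding one_outside_def by blast
qed

lemma finitary_diag_embed:
  assumes "finitary UNIV u"
  shows "finitary (block_indices \<alpha> k) (diag_embed \<alpha> k u)"
proof -
  obtain S where "finite S" "one_outside UNIV S u"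
    using assms by (auto simp: finitary_iff_one_outside)
  then have "finite (Inr ` ({..<k} \<times> S) :: block_index set)"
    "one_outside (block_indices \<alpha> k) (Inr ` ({..<k} \<times> S)) (diag_embed \<alpha> k u)"
    by (simp_all add: one_outside_diag_embed)
  then show ?thesis unfolding finitary_iff_one_outside by blast
qed

lemma diag_embed_inverse:
  assumes "u \<in> O_inf"
  shows "mat_mult (diag_embed \<alpha> k u) (diag_embed \<alpha> k (mat_transpose u)) = mat_one (block_indices \<alpha> k)"
    "mat_mult (diag_embed \<alpha> k (mat_transpose u)) (diag_embed \<alpha> k u) = mat_one (block_indices \<alpha> k)"
  using assms O_inf_transpose[OF assms]
  by (simp_all add: O_inf_def diag_embed_mult[symmetric] diag_embed_one)

lemma diag_embed_in_GL:
  assumes "u \<in> O_inf"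
  shows "diag_embed \<alpha> k u \<in> carrier (GL_inf \<alpha> k)"
  unfolding GL_inf_def GL_fin_def
  by (simp, intro conjI exI[of _ "diag_embed \<alpha> k (mat_transpose u)"])
    (simp_all add: assms diag_embed_inverse finitary_diag_embed O_inf_finitary O_inf_transpose)

lemma GL_inf_simps:
  "\<one>\<^bsub>GL_inf \<alpha> k\<^esub> = mat_one (block_indices \<alpha> k)" "A \<otimes>\<^bsub>GL_inf \<alpha> k\<^esub> B = mat_mult A B"
  by (simp_all add: GL_inf_def GL_fin_def)

lemma O_inf_one: "mat_one UNIV \<in> O_inf"
proof -
  have "mat_transpose (mat_one UNIV) = (mat_one UNIV :: (nat, 'a padic) matrix)"
    by (auto simp: fun_eq_iff mat_transpose_def mat_one_def)
  then show ?thesis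
    by (simp add: O_inf_def finitary_mat_one mat_mult_one_left) (simp add: mat_one_def Zp_0 Zp_1)
qed

lemma group_GL_inf: "group (GL_inf \<alpha> k)"
  unfolding GL_inf_def by (rule group_GL_fin)

lemma subgroup_K_sub: "subgroup (K_sub \<alpha> k) (GL_inf \<alpha> k :: (block_index, 'p::prime_card padic) matrix monoid)"
proof -
  interpret group "GL_inf \<alpha> k :: (block_index, 'p padic) matrix monoid" by (rule group_GL_inf)
  show ?thesis
  proof (rule subgroupI)
    show "K_sub \<alpha> k \<noteq> {}" using O_inf_one by (auto simp: K_sub_def)
    show "K_sub \<alpha> k \<subseteq> carrier (GL_inf \<alpha> k)" by (auto simp: K_sub_def diag_embed_in_GL)
    fix a :: "(block_index, 'p padic) matrix" assume "a \<in> K_sub \<alpha> k"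
    then obtain u where u: "u \<in> O_inf" "a = diag_embed \<alpha> k u" by (auto simp: K_sub_def)
    have "inv\<^bsub>GL_inf \<alpha> k\<^esub> a = diag_embed \<alpha> k (mat_transpose u)"
      using inv_equality[of "diag_embed \<alpha> k (mat_transpose u)" a] u diag_embed_inverse[OF u(1)]
      by (simp add: GL_inf_simps diag_embed_in_GL O_inf_transpose)
    then show "inv\<^bsub>GL_inf \<alpha> k\<^esub> a \<in> K_sub \<alpha> k"
      using u by (auto simp: K_sub_def O_inf_transpose)
    fix b :: "(block_index, 'p padic) matrix" assume "b \<in> K_sub \<alpha> k"
    then obtain v where v: "v \<in> O_inf" "b = diag_embed \<alpha> k v" by (auto simp: K_sub_def)
    show "a \<otimes>\<^bsub>GL_inf \<alpha> k\<^esub> b \<in> K_sub \<alpha> k"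
      unfolding GL_inf_simps K_sub_def u(2) v(2) diag_embed_mult[OF O_inf_finitary[OF u(1)], symmetric]
      using O_inf_mult[OF u(1) v(1)] by (rule imageI)
  qed
qed

section \<open>Permutation matrices\<close>

lemma permutes_inverseI:
  "(\<And>x. f (g x) = x) \<Longrightarrow> (\<And>x. g (f x) = x) \<Longrightarrow> (\<And>x. x \<notin> S \<Longrightarrow> f x = x) \<Longrightarrow> f permutes S"
  unfolding permutes_def by metis

text \<open>Row \<open>i\<close> has its entry 1 in column \<open>\<sigma> i\<close>. With this
  convention a matrix product reverses the order of composition.\<close>

definition perm_matrix :: "('i \<Rightarrow> 'i) \<Rightarrow> ('i, 'a::zero_neq_one) matrix" where
  "perm_matrix \<sigma> i j = (if \<sigma> i = j then 1 else 0)"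

lemma perm_matrix_mult_left: "mat_mult (perm_matrix \<sigma>) A i j = (A (\<sigma> i) j :: 'a::semiring_1)"
proof -
  have "mat_mult (perm_matrix \<sigma>) A i j = (\<Sum>l\<in>{\<sigma> i}. perm_matrix \<sigma> i l * A l j)"
    by (rule mat_mult_eq_sum) (auto simp: perm_matrix_def split: if_splits)
  then show ?thesis by (simp add: perm_matrix_def)
qed

lemma perm_matrix_mult: "mat_mult (perm_matrix \<sigma>) (perm_matrix \<tau>) =
    (perm_matrix (\<tau> \<circ> \<sigma>) :: ('i, 'a::semiring_1) matrix)"
  by (simp add: fun_eq_iff perm_matrix_mult_left) (simp add: perm_matrix_def)

lemma perm_matrix_id: "perm_matrix id = mat_one UNIV"
  by (simp add: fun_eq_iff perm_matrix_def mat_one_def)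

lemma perm_matrix_transpose:
  assumes "\<sigma> permutes S"
  shows "mat_transpose (perm_matrix \<sigma>) = perm_matrix (inv_into UNIV \<sigma>)"
  using permutes_inverses[OF assms] by (auto simp: fun_eq_iff mat_transpose_def perm_matrix_def)

lemma perm_matrix_mult_right:
  assumes "\<sigma> permutes S"
  shows "mat_mult A (perm_matrix \<sigma>) i j = (A i (inv_into UNIV \<sigma> j) :: 'a::semiring_1)"
proof -
  have "mat_mult A (perm_matrix \<sigma>) i j = (\<Sum>l\<in>{inv_into UNIV \<sigma> j}. A i l * perm_matrix \<sigma> l j)"
    by (rule mat_mult_eq_sum)
      (use permutes_inverses[OF assms] in \<open>auto simp: perm_matrix_def split: if_splits\<close>)
  then show ?thesis using permutes_inverses[OF assms] by (simp add: perm_matrix_def)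
qed

lemma one_outside_perm_matrix:
  assumes "\<sigma> permutes S"
  shows "one_outside UNIV S (perm_matrix \<sigma>)"
proof -
  have "i \<in> S \<and> \<sigma> i \<in> S" if "\<sigma> i \<noteq> i" for i
    using that permutes_not_in[OF assms, of i] permutes_in_image[OF assms, of i] by blast
  then show ?thesis unfolding one_outside_def perm_matrix_def mat_one_def by (metis UNIV_I)
qed

lemma perm_matrix_in_O_inf:
  assumes "\<sigma> permutes S" "finite S"
  shows "perm_matrix \<sigma> \<in> (O_inf :: (nat, 'p::prime_card padic) matrix set)"
proof -
  have "finitary UNIV (perm_matrix \<sigma> :: (nat, 'p padic) matrix)"
    using assms one_outside_perm_matrix finitary_iff_one_outside by blast
  moreover have "(perm_matrix \<sigma> i j :: 'p padic) \<in> Zp" for i j by (simp add: perm_matrix_def Zp_0 Zp_1)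
  ultimately show ?thesis
    using permutes_inv_o[OF assms(1)]
    by (simp add: O_inf_def perm_matrix_transpose[OF assms(1)] perm_matrix_mult perm_matrix_id)
qed

definition theta :: "nat \<Rightarrow> nat \<Rightarrow> nat" where
  "theta N i = (if i < N then i + N else if i < 2 * N then i - N else i)"

lemma theta_theta: "theta N (theta N i) = i"
  by (auto simp: theta_def)

lemma theta_permutes: "theta N permutes {..<2 * N}"
  by (rule permutes_inverseI[of _ "theta N", OF theta_theta theta_theta]) (auto simp: theta_def)

lemma inv_theta: "inv_into UNIV (theta N) = theta N"
  by (rule inv_unique_comp) (simp_all add: fun_eq_iff theta_theta)

lemma Theta_eq: "Theta N = perm_matrix (theta N)"
  by (auto simp: fun_eq_iff Theta_def perm_matrix_def theta_def)

lemma Theta_in_O_inf: "Theta N \<in> O_inf"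
  unfolding Theta_eq by (rule perm_matrix_in_O_inf[OF theta_permutes]) simp

lemma Theta_Theta: "mat_mult (Theta N) (Theta N) = (mat_one UNIV :: (nat, 'a::semiring_1) matrix)"
  by (simp add: Theta_eq perm_matrix_mult perm_matrix_id comp_def theta_theta flip: id_def)

text \<open>Its image under \<open>diag_embed\<close> plays the part of \<open>K' m\<close> in
  \<open>theta_system\<close>.\<close>

definition O_tail :: "nat \<Rightarrow> (nat, 'p::prime_card padic) matrix set" where
  "O_tail m = {u \<in> O_inf. one_outside UNIV {m..} u}"

text \<open>Conjugation by \<open>Theta N\<close> relabels indices by \<open>theta N\<close>, which
  moves the block \<open>{..<n}\<close> to indices at least \<open>N\<close>.\<close>

lemma Theta_conjugate_in_O_tail:
  assumes u: "u \<in> O_inf" and S: "one_outside UNIV {..<n} u" and "n \<le> N"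
  shows "mat_mult (Theta N) (mat_mult u (Theta N)) \<in> O_tail N"
proof -
  have "mat_mult (Theta N) (mat_mult u (Theta N)) i j = mat_one UNIV i j" if "i < N \<or> j < N" for i j
  proof -
    have "theta N i \<notin> {..<n} \<or> theta N j \<notin> {..<n}"
      using that \<open>n \<le> N\<close> by (auto simp: theta_def)
    note moved = one_outside_one[OF S this]
    have "mat_mult (Theta N) (mat_mult u (Theta N)) i j = u (theta N i) (theta N j)"
      by (simp add: Theta_eq perm_matrix_mult_left perm_matrix_mult_right[OF theta_permutes] inv_theta)
    also have "theta N i = theta N j \<longleftrightarrow> i = j"
      using theta_theta[of N i] theta_theta[of N j] by metis
    then have "u (theta N i) (theta N j) = mat_one UNIV i j"
      by (simp add: moved mat_one_def)
    finally show ?thesis .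
  qed
  then have "one_outside UNIV {N..} (mat_mult (Theta N) (mat_mult u (Theta N)))"
    unfolding one_outside_def by (meson UNIV_I atLeast_iff not_le)
  then show ?thesis
    using u by (simp add: O_tail_def O_inf_mult Theta_in_O_inf)
qed

lemma perm_matrix_in_O_tail:
  assumes "\<sigma> permutes S" "finite S" "\<And>i. i < m \<Longrightarrow> \<sigma> i = i"
  shows "perm_matrix \<sigma> \<in> (O_tail m :: (nat, 'p::prime_card padic) matrix set)"
proof -
  have "\<sigma> permutes {m..}"
    by (rule permutes_superset[OF assms(1)]) (use assms(3) in auto)
  then show ?thesis
    by (simp add: O_tail_def perm_matrix_in_O_inf[OF assms(1,2)] one_outside_perm_matrix)
qed

text \<open>
  The factor \<open>\<tau>\<close> carries \<open>N..<N + m\<close>, the image of \<open>{..<m}\<close> under \<open>theta N\<close>, to its image under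
  \<open>theta (Suc N)\<close>.
\<close>

lemma Theta_Suc:
  assumes "m \<le> N"
  shows "\<exists>\<sigma>\<in>O_tail m. \<exists>\<tau>\<in>O_tail m.
    (Theta (Suc N) :: (nat, 'p::prime_card padic) matrix) = mat_mult (mat_mult \<sigma> (Theta N)) \<tau>"
proof -
  define c where "c i = (if N \<le> i \<and> i < N + m then Suc i else if i = N + m then N else i)" for i
  define d where "d i = (if N < i \<and> i \<le> N + m then i - 1 else if i = N then N + m else i)" for i
  have cd: "c (d i) = i" "d (c i) = i" for i by (auto simp: c_def d_def)
  have c: "c permutes {..<N + m + 1}"
    by (rule permutes_inverseI[of _ d, OF cd]) (auto simp: c_def)
  have d: "d permutes {..<N + m + 1}"
    by (rule permutes_inverseI[of _ c, OF cd(2,1)]) (auto simp: d_def)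
  \<comment> \<open>Obtained by solving \<open>theta (Suc N) = c \<circ> theta N \<circ> ?s\<close>,
    with \<open>d\<close> the inverse of the cycle \<open>c\<close>.\<close>
  let ?s = "theta N \<circ> d \<circ> theta (Suc N)"
  let ?S = "{..<2 * N + m + 2}"
  have "?s permutes ?S"
    using assms by (intro permutes_compose permutes_subset[OF d] permutes_subset[OF theta_permutes]) auto
  moreover have "?s i = i" if "i < m" for i
    using that assms by (auto simp: theta_def d_def)
  ultimately have 1: "perm_matrix ?s \<in> (O_tail m :: (nat, 'p padic) matrix set)"
    by (intro perm_matrix_in_O_tail) auto
  have 2: "perm_matrix c \<in> (O_tail m :: (nat, 'p padic) matrix set)"
    by (rule perm_matrix_in_O_tail[OF c]) (use assms in \<open>auto simp: c_def\<close>)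
  have "(Theta (Suc N) :: (nat, 'p padic) matrix) =
      mat_mult (mat_mult (perm_matrix ?s) (Theta N)) (perm_matrix c)"
    by (simp add: Theta_eq perm_matrix_mult comp_def theta_theta cd)
  then show ?thesis using 1 2 by blast
qed

text \<open>Transfers the facts about orthogonal matrices and \<open>Theta N\<close> through the
  multiplicative map \<open>diag_embed\<close>, so that the abstract argument applies.\<close>

lemma theta_system_GL_inf:
  "theta_system (GL_inf \<alpha> k :: (block_index, 'p::prime_card padic) matrix monoid) (K_sub \<alpha> k)
    (\<lambda>m. diag_embed \<alpha> k ` O_tail m) (\<lambda>N. diag_embed \<alpha> k (Theta N))"
proof (intro theta_system.intro theta_system_axioms.intro group_GL_inf subgroup_K_sub)
  let ?D = "diag_embed \<alpha> k :: (nat, 'p padic) matrix \<Rightarrow> _"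
  show "?D ` O_tail m \<subseteq> K_sub \<alpha> k" for m
    by (auto simp: O_tail_def K_sub_def)
  show "?D ` O_tail n \<subseteq> ?D ` O_tail m" if "m \<le> n" for m n
    using that by (intro image_mono) (auto simp: O_tail_def intro: one_outside_mono)
  show "?D (Theta N) \<in> K_sub \<alpha> k" for N
    by (simp add: K_sub_def Theta_in_O_inf)
  show "\<exists>m. \<forall>u\<in>?D ` O_tail m. g \<otimes>\<^bsub>GL_inf \<alpha> k\<^esub> u = u \<otimes>\<^bsub>GL_inf \<alpha> k\<^esub> g"
    if g: "g \<in> carrier (GL_inf \<alpha> k)" for g :: "(block_index, 'p padic) matrix"
  proof -
    obtain S where S: "finite S" "one_outside (block_indices \<alpha> k) S g"
      using g by (auto simp: GL_inf_def GL_fin_def finitary_iff_one_outside)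
    \<comment> \<open>On indices \<open>Inl a\<close> the value of \<open>projr\<close> is
      unspecified, which is harmless: only a bound over the finite set \<open>S\<close> is
      taken.\<close>
    have "finite ((\<lambda>x. snd (projr x)) ` S)" using S(1) by simp
    then obtain m where m: "\<And>x. x \<in> S \<Longrightarrow> snd (projr x) < m"
      by (meson finite_nat_set_iff_bounded imageI)
    have "mat_mult g (?D u) = mat_mult (?D u) g" if "u \<in> O_tail m" for u
    proof (rule mat_mult_commute_one_outside[OF S(2)])
      show "one_outside (block_indices \<alpha> k) (Inr ` ({..<k} \<times> {m..})) (?D u)"
        using that by (intro one_outside_diag_embed) (simp add: O_tail_def)
      show "S \<inter> Inr ` ({..<k} \<times> {m..}) = {}" using m by fastforce
    qed
    then show ?thesis by (auto simp: GL_inf_simps)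
  qed
  \<comment> \<open>Because \<open>Theta N\<close> is an involution, the single conjugate of
    \<open>u\<close> by \<open>Theta N\<close> serves both for moving \<open>u\<close> to the right
    and for moving it to the left.\<close>
  have ex: "\<exists>n. \<forall>N\<ge>n. \<exists>v\<in>O_tail N.
      mat_mult u (Theta N) = mat_mult (Theta N) v \<and> mat_mult (Theta N) u = mat_mult v (Theta N)"
    if u: "u \<in> O_inf" for u :: "(nat, 'p padic) matrix"
  proof -
    obtain S where S: "finite S" "one_outside UNIV S u"
      using O_inf_finitary[OF u] by (auto simp: finitary_iff_one_outside)
    obtain n where "S \<subseteq> {..<n}" using S(1) finite_nat_bounded by blast
    then have n: "one_outside UNIV {..<n} u" using S(2) one_outside_mono by blast
    have fin: "finitary UNIV u" "finitary UNIV (Theta N :: (nat, 'p padic) matrix)" for N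
      using O_inf_finitary u Theta_in_O_inf by blast+
    have "\<exists>v\<in>O_tail N. mat_mult u (Theta N) = mat_mult (Theta N) v \<and>
        mat_mult (Theta N) u = mat_mult v (Theta N)" if "n \<le> N" for N
    proof (intro bexI conjI)
      let ?v = "mat_mult (Theta N) (mat_mult u (Theta N))"
      show "?v \<in> O_tail N" by (rule Theta_conjugate_in_O_tail[OF u n that])
      show "mat_mult u (Theta N) = mat_mult (Theta N) ?v"
        by (rule mat_mult_cancel_left[OF _ _ Theta_Theta, symmetric])
          (use fin finitary_mat_mult in blast)+
      show "mat_mult (Theta N) u = mat_mult ?v (Theta N)"
        using fin by (simp add: finitary_mat_mult_assoc[of UNIV] finitary_mat_mult Theta_Theta
            mat_mult_one_right)
    qed
    then show ?thesis by blast
  qed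
  note mult = diag_embed_mult[OF O_inf_finitary, symmetric]
  fix u :: "(block_index, 'p padic) matrix" assume "u \<in> K_sub \<alpha> k"
  then obtain u0 where u0: "u0 \<in> O_inf" "u = ?D u0" by (auto simp: K_sub_def)
  obtain n where n: "\<And>N. n \<le> N \<Longrightarrow> \<exists>v\<in>O_tail N.
      mat_mult u0 (Theta N) = mat_mult (Theta N) v \<and> mat_mult (Theta N) u0 = mat_mult v (Theta N)"
    using ex[OF u0(1)] by blast
  have "\<exists>u'\<in>?D ` O_tail N. mat_mult u (?D (Theta N)) = mat_mult (?D (Theta N)) u' \<and>
      mat_mult (?D (Theta N)) u = mat_mult u' (?D (Theta N))" if N: "n \<le> N" for N
  proof -
    obtain v where v: "v \<in> O_tail N" "mat_mult u0 (Theta N) = mat_mult (Theta N) v"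
      "mat_mult (Theta N) u0 = mat_mult v (Theta N)" using n[OF N] by blast
    then have "v \<in> O_inf" by (simp add: O_tail_def)
    then have "mat_mult u (?D (Theta N)) = mat_mult (?D (Theta N)) (?D v) \<and>
        mat_mult (?D (Theta N)) u = mat_mult (?D v) (?D (Theta N))"
      using v by (simp add: u0 mult Theta_in_O_inf)
    then show ?thesis using v(1) by blast
  qed
  then show "\<exists>n. \<forall>N\<ge>n. \<exists>u'\<in>?D ` O_tail N.
      u \<otimes>\<^bsub>GL_inf \<alpha> k\<^esub> ?D (Theta N) = ?D (Theta N) \<otimes>\<^bsub>GL_inf \<alpha> k\<^esub> u'"
    "\<exists>n. \<forall>N\<ge>n. \<exists>u'\<in>?D ` O_tail N.
      ?D (Theta N) \<otimes>\<^bsub>GL_inf \<alpha> k\<^esub> u = u' \<otimes>\<^bsub>GL_inf \<alpha> k\<^esub> ?D (Theta N)"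
    unfolding GL_inf_simps by blast+
next
  fix m N :: nat assume "m \<le> N"
  then obtain \<sigma> \<tau> :: "(nat, 'p padic) matrix" where st: "\<sigma> \<in> O_tail m" "\<tau> \<in> O_tail m"
    "Theta (Suc N) = mat_mult (mat_mult \<sigma> (Theta N)) \<tau>" using Theta_Suc by blast
  then have "\<sigma> \<in> O_inf" by (simp add: O_tail_def)
  then have "diag_embed \<alpha> k (Theta (Suc N)) =
      mat_mult (mat_mult (diag_embed \<alpha> k \<sigma>) (diag_embed \<alpha> k (Theta N))) (diag_embed \<alpha> k \<tau>)"
    by (simp add: st(3) diag_embed_mult O_inf_finitary O_inf_mult Theta_in_O_inf)
  then show "\<exists>\<sigma>\<in>diag_embed \<alpha> k ` O_tail m. \<exists>\<tau>\<in>diag_embed \<alpha> k ` O_tail m.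
      diag_embed \<alpha> k (Theta (Suc N) :: (nat, 'p padic) matrix) =
      \<sigma> \<otimes>\<^bsub>GL_inf \<alpha> k\<^esub> diag_embed \<alpha> k (Theta N) \<otimes>\<^bsub>GL_inf \<alpha> k\<^esub> \<tau>"
    unfolding GL_inf_simps using st(1,2) by blast
qed

theorem theorem2p2:
  fixes \<alpha> k :: nat
    and \<rho> :: "(block_index, 'p::prime_card padic) matrix \<Rightarrow> 'h::complex_hilbert \<Rightarrow> 'h"
    and \<gg> \<hh> :: "(block_index, 'p padic) matrix set"
  assumes "k \<ge> 1"
    and "unitary_rep (GL_inf \<alpha> k) \<rho>"
    and "\<gg> \<in> double_cosets (GL_inf \<alpha> k) (K_sub \<alpha> k)"
    and "\<hh> \<in> double_cosets (GL_inf \<alpha> k) (K_sub \<alpha> k)"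
  shows "compose (fixed_vectors \<rho> (K_sub \<alpha> k))
           (rho_bar_dc \<rho> (K_sub \<alpha> k) \<gg>) (rho_bar_dc \<rho> (K_sub \<alpha> k) \<hh>) =
         rho_bar_dc \<rho> (K_sub \<alpha> k) (dc_star \<alpha> k \<gg> \<hh>)"
proof -
  obtain g h where gh: "g \<in> carrier (GL_inf \<alpha> k)" "h \<in> carrier (GL_inf \<alpha> k)"
    "\<gg> = double_coset (GL_inf \<alpha> k) (K_sub \<alpha> k) g" "\<hh> = double_coset (GL_inf \<alpha> k) (K_sub \<alpha> k) h"
    using assms(3,4) by (auto simp: double_cosets_def)
  show ?thesis
    \<comment> \<open>The definition of \<open>dc_star\<close> becomes the definite description in
      \<open>rho_bar_star\<close>, with \<open>t N\<close> the embedded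
      \<open>Theta N\<close>.\<close>
    unfolding dc_star_def gh(3,4)
    by (rule theta_system.rho_bar_star[OF theta_system_GL_inf assms(2) gh(1,2)])
qed

end
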